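(* Let $n=\dim M$. For every $x\in M$ and every $0\neq\xi\in T_x^*M$, the symbol sequence $$0\to\Omega^0_x\otimes\mathrm{Sym}^\bullet(\mathcal{G}_x)\xrightarrow{\ \xi\wedge\ }\Omega^1_x\otimes\mathrm{Sym}^\bullet(\mathcal{G}_x)\xrightarrow{\ \xi\wedge\ }\cdots\xrightarrow{\ \xi\wedge\ }\Omega^n_x\otimes\mathrm{Sym}^\bullet(\mathcal{G}_x)\to0$$ is exact. Hence $(\mathcal{S}^\bullet,\mathcal{D}_{t,\lambda})$ is an elliptic complex.
   Context: Setting: $M$ is a closed connected smooth manifold, $G$ a compact connected semisimple Lie group, $P\to M$ a principal $G$-bundle with connection, $\mathcal{G}=\mathrm{ad}P$, $\lambda\in\Gamma(\mathrm{ad}^*P)\cong\Gamma(\mathrm{ad}P)$ (covariantly constant), $t\in\mathbb{R}$. Put $\mathcal{S}^N=\bigoplus_{p+q=N}\Omega^p(M)\otimes\mathrm{Sym}^q(\mathcal{G})$ and $\mathcal{D}_{t,\lambda}=d+(-1)^{\deg_{\mathrm{dR}}}\,t\,\delta^\lambda$, where $(-1)^{\deg_{\mathrm{dR}}}=(-1)^p$ on $\Omega^p(M)\otimes\mathrm{Sym}^q(\mathcal{G})$ and $\delta^\lambda:\mathrm{Sym}^q(\mathcal{G})\to\mathrm{Sym}^{q+1}(\mathcal{G})$ is a zero-order (fiberwise linear) operator with $(\delta^\lambda)^2=0$ and $[d,\delta^\lambda]=0$. $\Omega^p_x$ denotes $\Lambda^pT_x^*M$. A complex of first-order operators is elliptic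 if its principal symbol sequence is exact for every nonzero covector.
   Formalization: That the spaces and D form a complex needs d∘d = 0 (a flat induced connection), which is added as a premise for the final claim only; for a non-flat connection with λ = 0 and δ = 0 one has D² ≠ 0. Exactness of both symbol sequences is stated without it. *)

theory Defs
  imports "HOL-Analysis.Analysis" "HOL-Library.Function_Algebras"
begin

section \<open>Linear algebra on subspaces of function types\<close>

text \<open>Tangent spaces and the fibres of bundles vary with the base point, so they are modelled as
  linear subspaces of function types. Elements that are only meaningful on part of their domain are
  extended by 0, which makes equality of elements equality of functions.\<close>

instantiation "fun" :: (type, real_vector) real_vector
begin

definition scaleR_fun :: "real \<Rightarrow> ('a \<Rightarrow> 'b) \<Rightarrow> 'a \<Rightarrow> 'b"
  where "scaleR_fun a f = (\<lambda>x. a *\<^sub>R f x)"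

instance
  by standard (simp_all add: scaleR_fun_def fun_eq_iff algebra_simps)

end

lemma scaleR_fun_apply [simp]: "(a *\<^sub>R f) x = a *\<^sub>R f x"
  by (simp add: scaleR_fun_def)

definition lin_on :: "'a::real_vector set \<Rightarrow> ('a \<Rightarrow> 'b::real_vector) \<Rightarrow> bool" where
  "lin_on V f \<longleftrightarrow> (\<forall>u\<in>V. \<forall>v\<in>V. \<forall>a b. f (a *\<^sub>R u + b *\<^sub>R v) = a *\<^sub>R f u + b *\<^sub>R f v)"

definition dual :: "'a::real_vector set \<Rightarrow> ('a \<Rightarrow> real) set" where
  "dual V = {\<phi>. lin_on V \<phi> \<and> (\<forall>v. v \<notin> V \<longrightarrow> \<phi> v = 0)}"

text \<open>For a finite-dimensional real vector space \<open>V\<close>, the symmetric power \<open>Sym\<^sup>q V\<close> is the space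
  of homogeneous polynomial functions of degree \<open>q\<close> on the dual of \<open>V\<close>, the product
  \<open>v\<^sub>1 \<cdots> v\<^sub>q\<close> being the function \<open>\<phi> \<mapsto> \<phi> v\<^sub>1 \<cdots> \<phi> v\<^sub>q\<close>. Polynomial functions that are homogeneous of
  different degrees are linearly independent, so the span in \<open>sym_alg\<close> is the direct sum.\<close>

definition sym_pow :: "nat \<Rightarrow> 'a::real_vector set \<Rightarrow> (('a \<Rightarrow> real) \<Rightarrow> real) set" where
  "sym_pow q V = span {(\<lambda>\<phi>. if \<phi> \<in> dual V then prod_list (map \<phi> vs) else 0) | vs.
     length vs = q \<and> set vs \<subseteq> V}"

definition sym_alg :: "'a::real_vector set \<Rightarrow> (('a \<Rightarrow> real) \<Rightarrow> real) set" where
  "sym_alg V = span (\<Union>q. sym_pow q V)"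

text \<open>\<open>\<Lambda>\<^sup>p V\<^sup>* \<otimes> W\<close> as the space of alternating \<open>p\<close>-linear maps from \<open>V\<close> to \<open>W\<close>
  (\<open>V\<close> finite-dimensional); the \<open>p\<close> arguments are given as a list.\<close>

definition alt_forms :: "nat \<Rightarrow> 'a::real_vector set \<Rightarrow> 'b::real_vector set \<Rightarrow> ('a list \<Rightarrow> 'b) set" where
  "alt_forms p V W = {\<alpha>.
     (\<forall>vs. length vs = p \<and> set vs \<subseteq> V \<longrightarrow>
        \<alpha> vs \<in> W \<and> (\<forall>i<p. lin_on V (\<lambda>u. \<alpha> (vs[i := u]))) \<and> (\<not> distinct vs \<longrightarrow> \<alpha> vs = 0)) \<and>
     (\<forall>vs. \<not> (length vs = p \<and> set vs \<subseteq> V) \<longrightarrow> \<alpha> vs = 0)}"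

definition del_nth :: "nat \<Rightarrow> 'a list \<Rightarrow> 'a list" where
  "del_nth i xs = take i xs @ drop (Suc i) xs"

text \<open>\<open>\<xi> \<and> \<alpha>\<close> for a covector \<open>\<xi>\<close>, in the convention without factorials:
  \<open>(\<xi> \<and> \<alpha>)(v\<^sub>0, \<dots>, v\<^sub>p) = \<Sum>\<^sub>i (-1)\<^sup>i \<xi>(v\<^sub>i) \<alpha>(v\<^sub>0, \<dots>, omit v\<^sub>i, \<dots>, v\<^sub>p)\<close>.\<close>

definition wedge :: "('a \<Rightarrow> real) \<Rightarrow> ('a list \<Rightarrow> 'b::real_vector) \<Rightarrow> 'a list \<Rightarrow> 'b" where
  "wedge \<xi> \<alpha> = (\<lambda>vs. \<Sum>i<length vs. ((-1) ^ i * \<xi> (vs ! i)) *\<^sub>R \<alpha> (del_nth i vs))"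

text \<open>Exactness of \<open>0 \<rightarrow> E 0 \<rightarrow> E 1 \<rightarrow> \<dots> \<rightarrow> E n \<rightarrow> 0\<close> with maps \<open>f p : E p \<rightarrow> E (p + 1)\<close>.\<close>

definition exact_seq_upto :: "nat \<Rightarrow> (nat \<Rightarrow> 'a::real_vector set) \<Rightarrow> (nat \<Rightarrow> 'a \<Rightarrow> 'a) \<Rightarrow> bool" where
  "exact_seq_upto n E f \<longleftrightarrow>
     (\<forall>p<n. f p ` E p \<subseteq> E (Suc p)) \<and>
     (\<forall>p\<le>n. {u \<in> E p. p < n \<longrightarrow> f p u = 0} = (if p = 0 then {0} else f (p - 1) ` E (p - 1)))"


section \<open>Smooth manifolds\<close>

primrec Ck_on :: "nat \<Rightarrow> 'a::real_normed_vector set \<Rightarrow> ('a \<Rightarrow> 'b::real_normed_vector) \<Rightarrow> bool" where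
  "Ck_on 0 S f = continuous_on S f"
| "Ck_on (Suc k) S f =
     (f differentiable_on S \<and> (\<forall>v. Ck_on k S (\<lambda>x. frechet_derivative f (at x) v)))"

text \<open>Used for open sets \<open>S\<close> in finite-dimensional spaces only.\<close>

definition smooth_on :: "'a::real_normed_vector set \<Rightarrow> ('a \<Rightarrow> 'b::real_normed_vector) \<Rightarrow> bool" where
  "smooth_on S f \<longleftrightarrow> (\<forall>k. Ck_on k S f)"

type_synonym ('m, 'e) chart = "'m set \<times> ('m \<Rightarrow> 'e)"

definition chart_inv :: "('m, 'e) chart \<Rightarrow> 'e \<Rightarrow> 'm" where
  "chart_inv c = inv_into (fst c) (snd c)"

text \<open>A manifold is a type with an atlas. The model space is any finite-dimensional normed space
  rather than a \<open>euclidean_space\<close>, because the latter class excludes dimension 0.\<close>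

definition smooth_manifold ::
  "('m::{t2_space, second_countable_topology}, 'e::real_normed_vector) chart set \<Rightarrow> bool" where
  "smooth_manifold A \<longleftrightarrow>
     (\<exists>B::'e set. finite B \<and> span B = UNIV) \<and>
     (\<Union>c\<in>A. fst c) = UNIV \<and>
     (\<forall>c\<in>A. open (fst c) \<and> open (snd c ` fst c) \<and>
        homeomorphism (fst c) (snd c ` fst c) (snd c) (chart_inv c)) \<and>
     (\<forall>c\<in>A. \<forall>c'\<in>A. smooth_on (snd c ` (fst c \<inter> fst c')) (snd c' \<circ> chart_inv c))"

definition prod_atlas :: "('m, 'e) chart set \<Rightarrow> ('n, 'f) chart set \<Rightarrow> ('m \<times> 'n, 'e \<times> 'f) chart set" where
  "prod_atlas A B = (\<lambda>(c, d). (fst c \<times> fst d, map_prod (snd c) (snd d))) ` (A \<times> B)"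

definition smooth_map_on ::
  "('m::topological_space, 'e::real_normed_vector) chart set \<Rightarrow>
   ('n::topological_space, 'f::real_normed_vector) chart set \<Rightarrow> 'm set \<Rightarrow> ('m \<Rightarrow> 'n) \<Rightarrow> bool" where
  "smooth_map_on A B W f \<longleftrightarrow> continuous_on W f \<and>
     (\<forall>c\<in>A. \<forall>d\<in>B. smooth_on (snd c ` {x \<in> fst c \<inter> W. f x \<in> fst d}) (snd d \<circ> f \<circ> chart_inv c))"

definition smooth_fun_on ::
  "('m, 'e::real_normed_vector) chart set \<Rightarrow> 'm set \<Rightarrow> ('m \<Rightarrow> 'b::real_normed_vector) \<Rightarrow> bool" where
  "smooth_fun_on A W f \<longleftrightarrow> (\<forall>c\<in>A. smooth_on (snd c ` (fst c \<inter> W)) (f \<circ> chart_inv c))"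

text \<open>A tangent vector at \<open>x\<close> is a family of coordinate vectors, one for each chart around \<open>x\<close>,
  transforming by the derivatives of the coordinate changes.\<close>

type_synonym ('m, 'e) tvec = "('m, 'e) chart \<Rightarrow> 'e"

definition tspace :: "('m, 'e::real_normed_vector) chart set \<Rightarrow> 'm \<Rightarrow> ('m, 'e) tvec set" where
  "tspace A x = {v.
     (\<forall>c\<in>A. \<forall>c'\<in>A. x \<in> fst c \<inter> fst c' \<longrightarrow>
        v c' = frechet_derivative (snd c' \<circ> chart_inv c) (at (snd c x)) (v c)) \<and>
     (\<forall>c. \<not> (c \<in> A \<and> x \<in> fst c) \<longrightarrow> v c = 0)}"

text \<open>The derivative of \<open>f\<close> at \<open>x\<close> along \<open>v \<in> tspace A x\<close>; it does not depend on the chart.\<close>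

definition dirder ::
  "('m, 'e::real_normed_vector) chart set \<Rightarrow> ('m \<Rightarrow> 'b::real_normed_vector) \<Rightarrow> 'm \<Rightarrow> ('m, 'e) tvec \<Rightarrow> 'b" where
  "dirder A f x v = (let c = (SOME c. c \<in> A \<and> x \<in> fst c)
     in frechet_derivative (f \<circ> chart_inv c) (at (snd c x)) (v c))"

definition differential ::
  "('m, 'e::real_normed_vector) chart set \<Rightarrow> ('m \<Rightarrow> real) \<Rightarrow> 'm \<Rightarrow> ('m, 'e) tvec \<Rightarrow> real" where
  "differential A f x = (\<lambda>v. if v \<in> tspace A x then dirder A f x v else 0)"

definition tmap ::
  "('m, 'e::real_normed_vector) chart set \<Rightarrow> ('n, 'f::real_normed_vector) chart set \<Rightarrow>
   ('m \<Rightarrow> 'n) \<Rightarrow> 'm \<Rightarrow> ('m, 'e) tvec \<Rightarrow> ('n, 'f) tvec" where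
  "tmap A B f x v = (\<lambda>d. if d \<in> B \<and> f x \<in> fst d then dirder A (snd d \<circ> f) x v else 0)"

definition vfield_on ::
  "('m, 'e::real_normed_vector) chart set \<Rightarrow> 'm set \<Rightarrow> ('m \<Rightarrow> ('m, 'e) tvec) \<Rightarrow> bool" where
  "vfield_on A U X \<longleftrightarrow>
     (\<forall>x\<in>U. X x \<in> tspace A x) \<and> (\<forall>c\<in>A. smooth_fun_on A (U \<inter> fst c) (\<lambda>x. X x c))"

definition lie_bracket ::
  "('m, 'e::real_normed_vector) chart set \<Rightarrow> ('m \<Rightarrow> ('m, 'e) tvec) \<Rightarrow> ('m \<Rightarrow> ('m, 'e) tvec) \<Rightarrow>
   'm \<Rightarrow> ('m, 'e) tvec" where
  "lie_bracket A X Y x = (\<lambda>c. if c \<in> A \<and> x \<in> fst c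
     then dirder A (\<lambda>y. Y y c) x (X x) - dirder A (\<lambda>y. X y c) x (Y x) else 0)"


section \<open>Elliptic complexes of first-order operators\<close>

text \<open>\<open>E\<close> and \<open>F\<close> are families of fibres and \<open>\<Gamma>E\<close>, \<open>\<Gamma>F\<close> the spaces of smooth sections. An
  operator \<open>D\<close> has order at most one iff all commutators \<open>[D, f]\<close> with smooth functions are of order
  zero, and its principal symbol is then given by \<open>[D, f] s = \<sigma>(df) s\<close> (no factor \<open>\<i>\<close>).\<close>

definition has_principal_symbol ::
  "('m, 'e::real_normed_vector) chart set \<Rightarrow> ('m \<Rightarrow> 'v::real_vector set) \<Rightarrow> ('m \<Rightarrow> 'v set) \<Rightarrow>
   ('m \<Rightarrow> 'v) set \<Rightarrow> ('m \<Rightarrow> 'v) set \<Rightarrow> (('m \<Rightarrow> 'v) \<Rightarrow> 'm \<Rightarrow> 'v) \<Rightarrow>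
   ('m \<Rightarrow> (('m, 'e) tvec \<Rightarrow> real) \<Rightarrow> 'v \<Rightarrow> 'v) \<Rightarrow> bool" where
  "has_principal_symbol A E F \<Gamma>E \<Gamma>F D \<sigma> \<longleftrightarrow>
     D ` \<Gamma>E \<subseteq> \<Gamma>F \<and> lin_on \<Gamma>E D \<and>
     (\<forall>x. \<forall>\<xi>\<in>dual (tspace A x). \<sigma> x \<xi> ` E x \<subseteq> F x \<and> lin_on (E x) (\<sigma> x \<xi>)) \<and>
     (\<forall>x. \<forall>u\<in>E x. lin_on (dual (tspace A x)) (\<lambda>\<xi>. \<sigma> x \<xi> u)) \<and>
     (\<forall>f s x. smooth_fun_on A UNIV f \<and> s \<in> \<Gamma>E \<longrightarrow>
        D (\<lambda>y. f y *\<^sub>R s y) x - f x *\<^sub>R D s x = \<sigma> x (differential A f x) (s x))"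

text \<open>The principal symbols of the operators \<open>D N : \<Gamma> N \<rightarrow> \<Gamma> (N + 1)\<close>, \<open>N \<ge> 0\<close>, form an exact
  sequence at every nonzero covector. (The principal symbol is unique, since every covector is the
  differential of a smooth function and every vector in a fibre is the value of a smooth section.)\<close>

definition exact_symbols ::
  "('m, 'e::real_normed_vector) chart set \<Rightarrow> (nat \<Rightarrow> 'm \<Rightarrow> 'v::real_vector set) \<Rightarrow>
   (nat \<Rightarrow> ('m \<Rightarrow> 'v) set) \<Rightarrow> (nat \<Rightarrow> ('m \<Rightarrow> 'v) \<Rightarrow> 'm \<Rightarrow> 'v) \<Rightarrow> bool" where
  "exact_symbols A E \<Gamma> D \<longleftrightarrow>
     (\<exists>\<sigma>. (\<forall>N. has_principal_symbol A (E N) (E (Suc N)) (\<Gamma> N) (\<Gamma> (Suc N)) (D N) (\<sigma> N)) \<and>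
        (\<forall>x. \<forall>\<xi>\<in>dual (tspace A x). \<xi> \<noteq> 0 \<longrightarrow>
           (\<forall>N. {u \<in> E N x. \<sigma> N x \<xi> u = 0} =
              (if N = 0 then {0} else \<sigma> (N - 1) x \<xi> ` E (N - 1) x))))"

definition elliptic_complex ::
  "('m, 'e::real_normed_vector) chart set \<Rightarrow> (nat \<Rightarrow> 'm \<Rightarrow> 'v::real_vector set) \<Rightarrow>
   (nat \<Rightarrow> ('m \<Rightarrow> 'v) set) \<Rightarrow> (nat \<Rightarrow> ('m \<Rightarrow> 'v) \<Rightarrow> 'm \<Rightarrow> 'v) \<Rightarrow> bool" where
  "elliptic_complex A E \<Gamma> D \<longleftrightarrow>
     (\<forall>N. \<forall>s\<in>\<Gamma> N. D (Suc N) (D N s) = 0) \<and> exact_symbols A E \<Gamma> D"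


section \<open>Lie groups, principal bundles and connections\<close>

definition lie_group ::
  "('g::{t2_space, second_countable_topology}, 'k::real_normed_vector) chart set \<Rightarrow>
   ('g \<Rightarrow> 'g \<Rightarrow> 'g) \<Rightarrow> 'g \<Rightarrow> ('g \<Rightarrow> 'g) \<Rightarrow> bool" where
  "lie_group A m e i \<longleftrightarrow> smooth_manifold A \<and> group m e i \<and>
     smooth_map_on (prod_atlas A A) A UNIV (\<lambda>(x, y). m x y) \<and> smooth_map_on A A UNIV i"

text \<open>The bracket on the Lie algebra \<open>tspace A e\<close>: bracket of the left-invariant extensions.\<close>

definition alg_bracket ::
  "('g, 'k::real_normed_vector) chart set \<Rightarrow> ('g \<Rightarrow> 'g \<Rightarrow> 'g) \<Rightarrow> 'g \<Rightarrow>
   ('g, 'k) tvec \<Rightarrow> ('g, 'k) tvec \<Rightarrow> ('g, 'k) tvec" where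
  "alg_bracket A m e u v =
     lie_bracket A (\<lambda>g. tmap A A (m g) e u) (\<lambda>g. tmap A A (m g) e v) e"

text \<open>The Lie algebra has no nonzero solvable ideal.\<close>

definition semisimple ::
  "('g, 'k::real_normed_vector) chart set \<Rightarrow> ('g \<Rightarrow> 'g \<Rightarrow> 'g) \<Rightarrow> 'g \<Rightarrow> bool" where
  "semisimple A m e \<longleftrightarrow>
     (\<forall>I. subspace I \<and> I \<subseteq> tspace A e \<and> (\<forall>u\<in>tspace A e. \<forall>v\<in>I. alg_bracket A m e u v \<in> I) \<and>
        (\<exists>k. ((\<lambda>J. span {alg_bracket A m e u v | u v. u \<in> J \<and> v \<in> J}) ^^ k) I = {0})
      \<longrightarrow> I = {0})"

record ('m, 'e, 'g, 'k, 'p, 'r) gauge_bundle =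
  base :: "('m, 'e) chart set"
  grp :: "('g, 'k) chart set"
  mul :: "'g \<Rightarrow> 'g \<Rightarrow> 'g"
  unit :: 'g
  ginv :: "'g \<Rightarrow> 'g"
  tot :: "('p, 'r) chart set"
  proj :: "'p \<Rightarrow> 'm"
  act :: "'p \<Rightarrow> 'g \<Rightarrow> 'p"
  hor :: "'p \<Rightarrow> ('p, 'r) tvec set"

definition principal_bundle ::
  "('m::{t2_space, second_countable_topology}, 'e::real_normed_vector,
    'g::{t2_space, second_countable_topology}, 'k::real_normed_vector,
    'p::{t2_space, second_countable_topology}, 'r::real_normed_vector) gauge_bundle \<Rightarrow> bool" where
  "principal_bundle B \<longleftrightarrow>
     smooth_manifold (base B) \<and> lie_group (grp B) (mul B) (unit B) (ginv B) \<and>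
     smooth_manifold (tot B) \<and>
     smooth_map_on (tot B) (base B) UNIV (proj B) \<and>
     smooth_map_on (prod_atlas (tot B) (grp B)) (tot B) UNIV (\<lambda>(p, g). act B p g) \<and>
     (\<forall>p. act B p (unit B) = p) \<and>
     (\<forall>p g h. act B (act B p g) h = act B p (mul B g h)) \<and>
     (\<forall>x. \<exists>U \<Psi>. open U \<and> x \<in> U \<and> bij_betw \<Psi> (U \<times> UNIV) (proj B -` U) \<and>
        smooth_map_on (prod_atlas (base B) (grp B)) (tot B) (U \<times> UNIV) \<Psi> \<and>
        smooth_map_on (tot B) (prod_atlas (base B) (grp B)) (proj B -` U)
          (inv_into (U \<times> UNIV) \<Psi>) \<and>
        (\<forall>y\<in>U. \<forall>g h. proj B (\<Psi> (y, g)) = y \<and> act B (\<Psi> (y, g)) h = \<Psi> (y, mul B g h)))"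

definition hlift ::
  "('m, 'e::real_normed_vector, 'g, 'k, 'p, 'r::real_normed_vector) gauge_bundle \<Rightarrow>
   'p \<Rightarrow> ('m, 'e) tvec \<Rightarrow> ('p, 'r) tvec" where
  "hlift B p v = (THE w. w \<in> hor B p \<and> tmap (tot B) (base B) (proj B) p w = v)"

text \<open>A principal connection as a smooth invariant horizontal distribution. Since the kernel of the
  surjection \<open>d\<pi>\<close> is the vertical space, \<open>hor B p\<close> is a complement of the vertical space iff \<open>d\<pi>\<close>
  maps it bijectively to the tangent space of the base. The distribution is smooth iff horizontal
  lifts of smooth vector fields are smooth.\<close>

definition connection ::
  "('m::topological_space, 'e::real_normed_vector, 'g, 'k, 'p, 'r::real_normed_vector) gauge_bundle
   \<Rightarrow> bool" where
  "connection B \<longleftrightarrow>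
     (\<forall>p. subspace (hor B p) \<and> hor B p \<subseteq> tspace (tot B) p \<and>
        bij_betw (tmap (tot B) (base B) (proj B) p) (hor B p) (tspace (base B) (proj B p)) \<and>
        (\<forall>g. tmap (tot B) (tot B) (\<lambda>r. act B r g) p ` hor B p = hor B (act B p g))) \<and>
     (\<forall>U X. open U \<and> vfield_on (base B) U X \<longrightarrow>
        vfield_on (tot B) (proj B -` U) (\<lambda>p. hlift B p (X (proj B p))))"


section \<open>The adjoint bundle and its symmetric powers\<close>

definition liealg :: "('m, 'e, 'g, 'k::real_normed_vector, 'p, 'r) gauge_bundle \<Rightarrow> ('g, 'k) tvec set" where
  "liealg B = tspace (grp B) (unit B)"

definition Ad ::
  "('m, 'e, 'g, 'k::real_normed_vector, 'p, 'r) gauge_bundle \<Rightarrow> 'g \<Rightarrow> ('g, 'k) tvec \<Rightarrow> ('g, 'k) tvec" where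
  "Ad B g u = tmap (grp B) (grp B) (\<lambda>h. mul B (mul B g h) (ginv B g)) (unit B) u"

type_synonym ('g, 'k, 'p) ad_elt = "'p \<Rightarrow> ('g, 'k) tvec"
type_synonym ('g, 'k, 'p) coad_elt = "('g, 'k, 'p) ad_elt \<Rightarrow> real"
type_synonym ('g, 'k, 'p) sym_elt = "('g, 'k, 'p) coad_elt \<Rightarrow> real"
type_synonym ('m, 'e, 'g, 'k, 'p) form = "('m, 'e) tvec list \<Rightarrow> ('g, 'k, 'p) sym_elt"

text \<open>A point of the associated bundle over \<open>x\<close> is an orbit
  \<open>[p, u] = {(p \<cdot> g, Ad (g\<^sup>-\<^sup>1) u)}\<close>, which is the graph of an equivariant map from the fibre over \<open>x\<close>
  to the Lie algebra; the fibre of the adjoint bundle is the space of these maps.\<close>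

definition ad_fibre ::
  "('m, 'e, 'g, 'k::real_normed_vector, 'p, 'r) gauge_bundle \<Rightarrow> 'm \<Rightarrow> ('g, 'k, 'p) ad_elt set" where
  "ad_fibre B x = {h. \<forall>p.
     (proj B p = x \<longrightarrow> h p \<in> liealg B \<and> (\<forall>g. h (act B p g) = Ad B (ginv B g) (h p))) \<and>
     (proj B p \<noteq> x \<longrightarrow> h p = 0)}"

definition ad_class ::
  "('m, 'e, 'g, 'k::real_normed_vector, 'p, 'r) gauge_bundle \<Rightarrow> 'p \<Rightarrow> ('g, 'k) tvec \<Rightarrow> ('g, 'k, 'p) ad_elt" where
  "ad_class B p u = (THE h. h \<in> ad_fibre B (proj B p) \<and> h p = u)"

text \<open>The point \<open>p\<close> identifies the fibre of \<open>ad P\<close> over \<open>proj B p\<close> with the Lie algebra by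
  \<open>h \<mapsto> h p\<close>; \<open>coad_class B p\<close> is the induced identification of the dual spaces. A section \<open>F\<close> of
  \<open>Sym\<^sup>q (ad P)\<close> thereby becomes the equivariant function \<open>p \<mapsto> (\<psi> \<mapsto> F (proj B p) (coad_class B p \<psi>))\<close>
  on \<open>P\<close> with values in the polynomial functions on the dual of the Lie algebra. Smoothness and
  covariant derivatives of sections are those of the equivariant functions.\<close>

definition coad_class ::
  "('m, 'e, 'g, 'k::real_normed_vector, 'p, 'r) gauge_bundle \<Rightarrow> 'p \<Rightarrow> (('g, 'k) tvec \<Rightarrow> real) \<Rightarrow>
   ('g, 'k, 'p) coad_elt" where
  "coad_class B p \<psi> = (\<lambda>h. if h \<in> ad_fibre B (proj B p) then \<psi> (h p) else 0)"

text \<open>A smooth covariantly constant section of the coadjoint bundle.\<close>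

definition parallel_coad_section ::
  "('m, 'e::real_normed_vector, 'g, 'k::real_normed_vector, 'p, 'r::real_normed_vector) gauge_bundle \<Rightarrow>
   ('m \<Rightarrow> ('g, 'k, 'p) coad_elt) \<Rightarrow> bool" where
  "parallel_coad_section B lam \<longleftrightarrow>
     (\<forall>x. lam x \<in> dual (ad_fibre B x)) \<and>
     (\<forall>u\<in>liealg B. smooth_fun_on (tot B) UNIV (\<lambda>p. lam (proj B p) (ad_class B p u)) \<and>
        (\<forall>p. \<forall>w\<in>hor B p. dirder (tot B) (\<lambda>r. lam (proj B r) (ad_class B r u)) p w = 0))"

text \<open>\<open>\<Omega>\<^sup>p(M) \<otimes> Sym\<^sup>q(ad P)\<close>: smooth \<open>p\<close>-forms on \<open>M\<close> with values in \<open>Sym\<^sup>q(ad P)\<close>.\<close>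

definition sym_forms ::
  "('m::topological_space, 'e::real_normed_vector, 'g, 'k::real_normed_vector, 'p,
    'r::real_normed_vector) gauge_bundle \<Rightarrow> nat \<Rightarrow> nat \<Rightarrow> ('m \<Rightarrow> ('m, 'e, 'g, 'k, 'p) form) set" where
  "sym_forms B p q = {\<alpha>.
     (\<forall>x. \<alpha> x \<in> alt_forms p (tspace (base B) x) (sym_pow q (ad_fibre B x))) \<and>
     (\<forall>U Xs. open U \<and> length Xs = p \<and> (\<forall>X\<in>set Xs. vfield_on (base B) U X) \<longrightarrow>
        (\<forall>\<psi>\<in>dual (liealg B). smooth_fun_on (tot B) (proj B -` U)
           (\<lambda>r. \<alpha> (proj B r) (map (\<lambda>X. X (proj B r)) Xs) (coad_class B r \<psi>))))}"

text \<open>The value of \<open>\<nabla>\<^sub>v F\<close> at the dual element \<open>coad_class B r \<psi>\<close>, where \<open>v\<close> is a tangent vector at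
  \<open>proj B r\<close>: differentiate the equivariant function of \<open>F\<close> along the horizontal lift of \<open>v\<close>.\<close>

definition nabla ::
  "('m, 'e::real_normed_vector, 'g, 'k::real_normed_vector, 'p, 'r::real_normed_vector) gauge_bundle \<Rightarrow>
   ('m \<Rightarrow> ('g, 'k, 'p) sym_elt) \<Rightarrow> 'p \<Rightarrow> ('m, 'e) tvec \<Rightarrow> (('g, 'k) tvec \<Rightarrow> real) \<Rightarrow> real" where
  "nabla B F r v \<psi> = dirder (tot B) (\<lambda>r'. F (proj B r') (coad_class B r' \<psi>)) r (hlift B r v)"

text \<open>\<open>d\<close> is the covariant exterior derivative on \<open>\<Omega>\<^sup>p(M) \<otimes> Sym\<^sup>q(ad P)\<close>, given by
  \<open>(d \<alpha>)(X\<^sub>0, \<dots>, X\<^sub>p) = \<Sum>\<^sub>i (-1)\<^sup>i \<nabla>\<^bsub>X\<^sub>i\<^esub> (\<alpha>(\<dots>, omit X\<^sub>i, \<dots>))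
     + \<Sum>\<^bsub>i<j\<^esub> (-1)\<^sup>i\<^sup>+\<^sup>j \<alpha>([X\<^sub>i, X\<^sub>j], \<dots>, omit X\<^sub>i, \<dots>, omit X\<^sub>j, \<dots>)\<close>
  for vector fields on open subsets. This determines \<open>d\<close> on all forms.\<close>

definition covariant_ext_derivative ::
  "('m::topological_space, 'e::real_normed_vector, 'g, 'k::real_normed_vector, 'p,
    'r::real_normed_vector) gauge_bundle \<Rightarrow>
   (('m \<Rightarrow> ('m, 'e, 'g, 'k, 'p) form) \<Rightarrow> 'm \<Rightarrow> ('m, 'e, 'g, 'k, 'p) form) \<Rightarrow> bool" where
  "covariant_ext_derivative B d \<longleftrightarrow>
     (\<forall>p q. \<forall>\<alpha>\<in>sym_forms B p q. d \<alpha> \<in> sym_forms B (Suc p) q \<and>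
        (\<forall>U Xs. open U \<and> length Xs = Suc p \<and> (\<forall>X\<in>set Xs. vfield_on (base B) U X) \<longrightarrow>
           (\<forall>r \<psi>. proj B r \<in> U \<and> \<psi> \<in> dual (liealg B) \<longrightarrow>
              d \<alpha> (proj B r) (map (\<lambda>X. X (proj B r)) Xs) (coad_class B r \<psi>) =
              (\<Sum>i<Suc p. (-1) ^ i *
                 nabla B (\<lambda>y. \<alpha> y (map (\<lambda>X. X y) (del_nth i Xs))) r ((Xs ! i) (proj B r)) \<psi>) +
              (\<Sum>j<Suc p. \<Sum>i<j. (-1) ^ (i + j) *
                 \<alpha> (proj B r)
                   (lie_bracket (base B) (Xs ! i) (Xs ! j) (proj B r) #
                    map (\<lambda>X. X (proj B r)) (del_nth i (del_nth j Xs)))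
                   (coad_class B r \<psi>)))))"

text \<open>A smooth fibrewise linear operator \<open>Sym\<^sup>q(ad P) \<rightarrow> Sym\<^sup>q\<^sup>+\<^sup>1(ad P)\<close> for all \<open>q\<close>, and its
  extension \<open>1 \<otimes> \<delta>\<close> to forms.\<close>

definition on_forms ::
  "('m \<Rightarrow> ('g, 'k, 'p) sym_elt \<Rightarrow> ('g, 'k, 'p) sym_elt) \<Rightarrow>
   ('m \<Rightarrow> ('m, 'e, 'g, 'k, 'p) form) \<Rightarrow> 'm \<Rightarrow> ('m, 'e, 'g, 'k, 'p) form" where
  "on_forms \<delta> \<alpha> = (\<lambda>x vs. \<delta> x (\<alpha> x vs))"

definition zero_order_raising ::
  "('m::topological_space, 'e::real_normed_vector, 'g, 'k::real_normed_vector, 'p,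
    'r::real_normed_vector) gauge_bundle \<Rightarrow>
   ('m \<Rightarrow> ('g, 'k, 'p) sym_elt \<Rightarrow> ('g, 'k, 'p) sym_elt) \<Rightarrow> bool" where
  "zero_order_raising B \<delta> \<longleftrightarrow>
     (\<forall>x q. \<delta> x ` sym_pow q (ad_fibre B x) \<subseteq> sym_pow (Suc q) (ad_fibre B x) \<and>
        lin_on (sym_pow q (ad_fibre B x)) (\<delta> x)) \<and>
     (\<forall>p q. on_forms \<delta> ` sym_forms B p q \<subseteq> sym_forms B p (Suc q))"

text \<open>The bundle underlying \<open>S\<^sup>N\<close>, its smooth sections, and the operator \<open>D\<close>. An element of the
  direct sum is a sequence whose \<open>p\<close>-th entry is the component of form degree \<open>p\<close>.\<close>

definition S_fibre ::
  "('m, 'e::real_normed_vector, 'g, 'k::real_normed_vector, 'p, 'r) gauge_bundle \<Rightarrow> nat \<Rightarrow> 'm \<Rightarrow>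
   (nat \<Rightarrow> ('m, 'e, 'g, 'k, 'p) form) set" where
  "S_fibre B N x = {u.
     (\<forall>p\<le>N. u p \<in> alt_forms p (tspace (base B) x) (sym_pow (N - p) (ad_fibre B x))) \<and>
     (\<forall>p>N. u p = 0)}"

definition S_sections ::
  "('m::topological_space, 'e::real_normed_vector, 'g, 'k::real_normed_vector, 'p,
    'r::real_normed_vector) gauge_bundle \<Rightarrow> nat \<Rightarrow> ('m \<Rightarrow> nat \<Rightarrow> ('m, 'e, 'g, 'k, 'p) form) set" where
  "S_sections B N = {s. (\<forall>x. s x \<in> S_fibre B N x) \<and> (\<forall>p\<le>N. (\<lambda>x. s x p) \<in> sym_forms B p (N - p))}"

definition D_op ::
  "(('m \<Rightarrow> ('m, 'e, 'g, 'k, 'p) form) \<Rightarrow> 'm \<Rightarrow> ('m, 'e, 'g, 'k, 'p) form) \<Rightarrow>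
   ('m \<Rightarrow> ('g, 'k, 'p) sym_elt \<Rightarrow> ('g, 'k, 'p) sym_elt) \<Rightarrow> real \<Rightarrow>
   ('m \<Rightarrow> nat \<Rightarrow> ('m, 'e, 'g, 'k, 'p) form) \<Rightarrow> 'm \<Rightarrow> nat \<Rightarrow> ('m, 'e, 'g, 'k, 'p) form" where
  "D_op d \<delta> t s x p =
     (if p = 0 then 0 else d (\<lambda>y. s y (p - 1)) x) + ((-1) ^ p * t) *\<^sub>R on_forms \<delta> (\<lambda>y. s y p) x"

end

theory Submission
  imports Defs
begin

text \<open>If \<open>\<xi> v = 1\<close>, then contraction with \<open>v\<close> is a contracting homotopy for exterior multiplication
  by \<open>\<xi>\<close>, with coefficients in any vector space; this gives exactness of the symbol sequence. Since
  \<open>\<delta>\<close> is fibrewise linear, it does not contribute to the commutator of the operator with a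
  function \<open>f\<close>. Evaluated on vector fields, the formula for \<open>d\<close> gives \<open>[d, f] \<alpha> = df \<and> \<alpha>\<close>, because
  the bracket terms cancel and the derivative of \<open>f \<circ> \<pi>\<close> along the horizontal lift of \<open>v\<close> is
  \<open>df(v)\<close>. So the symbol on \<open>S\<^sup>N\<close> is exterior multiplication by \<open>\<xi>\<close> in each form degree.\<close>

section \<open>Calculus of smooth functions\<close>

text \<open>The covariant exterior derivative is given only by a formula on vector fields over open
  sets, evaluated at dual elements that a point of \<open>P\<close> induces from the Lie algebra;
  not even its additivity is assumed. To turn this into a statement about
  \<open>d \<alpha> x\<close> as an element of a fibre, there must be enough test data: every
  tangent vector has to extend to a local smooth field, and every functional on a fibre of the
  adjoint bundle has to come from the Lie algebra. The first demand is behind the chain rule for C^k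
  maps, which is proved in coordinates because the model spaces are finite-dimensional normed spaces
  without a given inner product. The second rests on linearity of the adjoint action, hence on
  differentiability of group translations. On the algebraic side, the symbol raises the form degree
  by one and keeps the symmetric degree \<open>q\<close>, so the symbol sequence of the total
  complex splits into one sequence for each \<open>q\<close>. The end of the displayed sequence at
  degree \<open>n\<close> is a separate matter, settled by a dimension count.\<close>

lemma frechet_derivative_cong_open:
  assumes "open S" "x \<in> S" "\<And>y. y \<in> S \<Longrightarrow> f y = g y"
  shows "frechet_derivative f (at x) = frechet_derivative g (at x)"
proof -
  have "(f has_derivative f') (at x) \<longleftrightarrow> (g has_derivative f') (at x)" for f'
    using assms by (metis (no_types, lifting) has_derivative_transform_within_open)
  then show ?thesis by (simp add: frechet_derivative_def)
qed

lemma differentiable_on_open_cong: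
  assumes "open S" "\<And>y. y \<in> S \<Longrightarrow> f y = g y" "f differentiable_on S"
  shows "g differentiable_on S"
  using assms unfolding differentiable_on_def differentiable_def
  by (metis has_derivative_transform)

text \<open>Openness matters because \<open>frechet_derivative f (at x)\<close> sees
  \<open>f\<close> on a whole neighbourhood of \<open>x\<close>.\<close>

lemma Ck_on_cong:
  assumes "open S" "\<And>x. x \<in> S \<Longrightarrow> f x = g x" "Ck_on k S f"
  shows "Ck_on k S g"
  using assms(2,3)
proof (induction k arbitrary: f g)
  case 0
  then show ?case by (metis Ck_on.simps(1) continuous_on_cong)
next
  case (Suc k)
  have "Ck_on k S (\<lambda>x. frechet_derivative g (at x) v)" for v
  proof (rule Suc.IH)
    show "Ck_on k S (\<lambda>x. frechet_derivative f (at x) v)" using Suc.prems by simp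
    show "frechet_derivative f (at x) v = frechet_derivative g (at x) v" if "x \<in> S" for x
      using frechet_derivative_cong_open[OF assms(1) that] Suc.prems(1) by metis
  qed
  then show ?case using Suc.prems differentiable_on_open_cong[OF assms(1)] by auto
qed

lemma Ck_on_subset:
  assumes "Ck_on k S f" "T \<subseteq> S"
  shows "Ck_on k T f"
  using assms(1)
proof (induction k arbitrary: f)
  case 0
  then show ?case using assms(2) continuous_on_subset by auto
next
  case (Suc k)
  then show ?case using assms(2) differentiable_on_subset by auto
qed

lemma Ck_on_local:
  assumes "\<And>x. x \<in> S \<Longrightarrow> \<exists>T. open T \<and> x \<in> T \<and> Ck_on k T f"
  shows "Ck_on k S f"
  using assms
proof (induction k arbitrary: f)
  case 0
  have "continuous (at x) f" if "x \<in> S" for x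
    using 0 that continuous_on_eq_continuous_at by (metis Ck_on.simps(1))
  then show ?case by (simp add: continuous_at_imp_continuous_on)
next
  case (Suc k)
  have "f differentiable at x" if "x \<in> S" for x
    using Suc.prems[OF that] by (metis Ck_on.simps(2) differentiable_on_eq_differentiable_at)
  then have "f differentiable_on S"
    using differentiable_at_imp_differentiable_on by blast
  moreover have "Ck_on k S (\<lambda>x. frechet_derivative f (at x) v)" for v
  proof (rule Suc.IH)
    fix x assume "x \<in> S"
    then show "\<exists>T. open T \<and> x \<in> T \<and> Ck_on k T (\<lambda>x. frechet_derivative f (at x) v)"
      using Suc.prems by (metis Ck_on.simps(2))
  qed
  ultimately show ?case by simp
qed

text \<open>The product and chain rules need this in their inductions: the derivative of a product
  still contains the undifferentiated factors.\<close>

lemma Ck_on_Suc_imp: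
  assumes "Ck_on (Suc k) S f"
  shows "Ck_on k S f"
  using assms
proof (induction k arbitrary: f)
  case 0
  then show ?case by (simp add: differentiable_imp_continuous_on)
next
  case (Suc k)
  then show ?case by (metis Ck_on.simps(2))
qed

lemma Ck_on_const: "Ck_on k S (\<lambda>x. c)"
  by (induction k arbitrary: c) (auto simp: frechet_derivative_const)

lemma Ck_on_add:
  assumes "open S" "Ck_on k S f" "Ck_on k S g"
  shows "Ck_on k S (\<lambda>x. f x + g x)"
  using assms(2,3)
proof (induction k arbitrary: f g)
  case 0
  then show ?case by (auto intro: continuous_on_add)
next
  case (Suc k)
  have df: "f differentiable at x" "g differentiable at x" if "x \<in> S" for x
    using Suc.prems that assms(1) by (auto simp: differentiable_on_eq_differentiable_at)
  have "Ck_on k S (\<lambda>x. frechet_derivative (\<lambda>x. f x + g x) (at x) v)" for v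
  proof (rule Ck_on_cong[OF assms(1)])
    show "Ck_on k S (\<lambda>x. frechet_derivative f (at x) v + frechet_derivative g (at x) v)"
      using Suc by simp
    show "frechet_derivative f (at x) v + frechet_derivative g (at x) v =
      frechet_derivative (\<lambda>x. f x + g x) (at x) v" if "x \<in> S" for x
      using frechet_derivative_at[OF has_derivative_add[OF df(1)[OF that, unfolded frechet_derivative_works] df(2)[OF that, unfolded frechet_derivative_works]]]
      by metis
  qed
  then show ?case using Suc.prems by (auto intro: differentiable_on_add)
qed

lemma Ck_on_sum:
  assumes "open S" "\<And>i. i \<in> I \<Longrightarrow> Ck_on k S (f i)"
  shows "Ck_on k S (\<lambda>x. \<Sum>i\<in>I. f i x)"
  using assms(2)
proof (induction I rule: infinite_finite_induct)
  case (insert i I)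
  then show ?case using Ck_on_add[OF assms(1), of k "f i" "\<lambda>x. \<Sum>i\<in>I. f i x"] by simp
qed (auto simp: Ck_on_const)

lemma Ck_on_scaleR:
  fixes f :: "'a::real_normed_vector \<Rightarrow> real" and g :: "'a \<Rightarrow> 'b::real_normed_vector"
  assumes "open S" "Ck_on k S f" "Ck_on k S g"
  shows "Ck_on k S (\<lambda>x. f x *\<^sub>R g x)"
  using assms(2,3)
proof (induction k arbitrary: f g)
  case 0
  then show ?case by (auto intro: continuous_on_scaleR)
next
  case (Suc k)
  have df: "f differentiable at x" "g differentiable at x" if "x \<in> S" for x
    using Suc.prems that assms(1) by (auto simp: differentiable_on_eq_differentiable_at)
  have D: "((\<lambda>x. f x *\<^sub>R g x) has_derivative
     (\<lambda>v. f x *\<^sub>R frechet_derivative g (at x) v + frechet_derivative f (at x) v *\<^sub>R g x)) (at x)"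
    if "x \<in> S" for x
    using has_derivative_scaleR[OF df(1)[OF that, unfolded frechet_derivative_works] df(2)[OF that, unfolded frechet_derivative_works]] .
  have "Ck_on k S (\<lambda>x. frechet_derivative (\<lambda>x. f x *\<^sub>R g x) (at x) v)" for v
  proof (rule Ck_on_cong[OF assms(1)])
    show "Ck_on k S (\<lambda>x. f x *\<^sub>R frechet_derivative g (at x) v + frechet_derivative f (at x) v *\<^sub>R g x)"
      using Suc.prems Suc.prems[THEN Ck_on_Suc_imp] by (intro Ck_on_add[OF assms(1)] Suc.IH) simp_all
    show "f x *\<^sub>R frechet_derivative g (at x) v + frechet_derivative f (at x) v *\<^sub>R g x =
      frechet_derivative (\<lambda>x. f x *\<^sub>R g x) (at x) v" if "x \<in> S" for x
      using frechet_derivative_at[OF D[OF that]] by metis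
  qed
  moreover have "(\<lambda>x. f x *\<^sub>R g x) differentiable_on S"
    using D by (meson differentiableI differentiable_at_imp_differentiable_on)
  ultimately show ?case by simp
qed

lemma Ck_on_bounded_linear:
  assumes "open S" "bounded_linear L" "Ck_on k S f"
  shows "Ck_on k S (\<lambda>x. L (f x))"
  using assms(3)
proof (induction k arbitrary: f)
  case 0
  then show ?case using assms(2) by (auto intro: bounded_linear.continuous_on)
next
  case (Suc k)
  have df: "f differentiable at x" if "x \<in> S" for x
    using Suc.prems that assms(1) by (auto simp: differentiable_on_eq_differentiable_at)
  have D: "((\<lambda>x. L (f x)) has_derivative (\<lambda>v. L (frechet_derivative f (at x) v))) (at x)"
    if "x \<in> S" for x
    using bounded_linear.has_derivative[OF assms(2) df[OF that, unfolded frechet_derivative_works]] .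
  have "Ck_on k S (\<lambda>x. frechet_derivative (\<lambda>x. L (f x)) (at x) v)" for v
  proof (rule Ck_on_cong[OF assms(1)])
    show "Ck_on k S (\<lambda>x. L (frechet_derivative f (at x) v))"
      using Suc by simp
    show "L (frechet_derivative f (at x) v) =
      frechet_derivative (\<lambda>x. L (f x)) (at x) v" if "x \<in> S" for x
      using frechet_derivative_at[OF D[OF that]] by metis
  qed
  moreover have "(\<lambda>x. L (f x)) differentiable_on S"
    using D by (meson differentiableI differentiable_at_imp_differentiable_on)
  ultimately show ?case by simp
qed

text \<open>By induction on \<open>B\<close>: the bound for \<open>B\<close> makes its span complete, so a new basis vector has
  positive distance from that span.\<close>

lemma independent_coefficients_bounded:
  fixes B :: "'a::real_normed_vector set"
  assumes "finite B" "independent B"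
  shows "\<exists>C. \<forall>a. (\<Sum>b\<in>B. \<bar>a b\<bar>) \<le> C * norm (\<Sum>b\<in>B. a b *\<^sub>R b)"
  using assms
proof (induction B)
  case empty
  then show ?case by auto
next
  case (insert b B)
  have indep: "independent B" and b: "b \<notin> span B"
    using insert by (auto simp: independent_insert)
  obtain C where C: "\<And>a. (\<Sum>b\<in>B. \<bar>a b\<bar>) \<le> C * norm (\<Sum>b\<in>B. a b *\<^sub>R b)"
    using insert.IH indep by auto
  define C' where "C' = max C 0"
  have C': "(\<Sum>b\<in>B. \<bar>a b\<bar>) \<le> C' * norm (\<Sum>b\<in>B. a b *\<^sub>R b)" "C' \<ge> 0" for a
    using C[of a] mult_right_mono[of C C' "norm (\<Sum>b\<in>B. a b *\<^sub>R b)"] by (auto simp: C'_def)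
  have "\<exists>\<epsilon>>0. \<forall>y\<in>span B. \<epsilon> \<le> norm (b - y)"
  proof (rule ccontr)
    assume "\<not> ?thesis"
    then have "\<forall>\<epsilon>>0. \<exists>y\<in>span B. norm (b - y) < \<epsilon>" by (auto simp: not_le)
    then have "\<forall>n::nat. \<exists>y\<in>span B. norm (b - y) < 1 / real (Suc n)" by auto
    then obtain y where y: "\<And>n. y n \<in> span B" "\<And>n. norm (b - y n) < 1 / real (Suc n)" by metis
    have "\<forall>n. \<exists>a. y n = (\<Sum>c\<in>B. a c *\<^sub>R c)"
      using y(1) span_finite[OF insert.hyps(1)] by auto
    then obtain a where a: "\<And>n. y n = (\<Sum>c\<in>B. a n c *\<^sub>R c)" by metis
    have lim: "y \<longlonglongrightarrow> b"
    proof (rule LIMSEQ_norm_0[THEN LIM_zero_cancel])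
      show "norm (y n - b) < 1 / real (Suc n)" for n using y(2)[of n] by (simp add: norm_minus_commute)
    qed
    have "Cauchy (\<lambda>n. a n c)" if "c \<in> B" for c
    proof (rule CauchyI)
      fix e :: real assume "e > 0"
      \<comment> \<open>\<open>C'\<close> may be 0, so the denominator is shifted by 1.\<close>
      then have "e / (C' + 1) > 0" using C'(2) by auto
      then obtain M where M: "\<And>m n. m \<ge> M \<Longrightarrow> n \<ge> M \<Longrightarrow> norm (y m - y n) < e / (C' + 1)"
        using LIMSEQ_imp_Cauchy[OF lim] unfolding Cauchy_iff by blast
      show "\<exists>M. \<forall>m\<ge>M. \<forall>n\<ge>M. norm (a m c - a n c) < e"
      proof (intro exI allI impI)
        fix m n assume mn: "m \<ge> M" "n \<ge> M"
        have "norm (a m c - a n c) \<le> (\<Sum>c\<in>B. \<bar>a m c - a n c\<bar>)"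
          using member_le_sum[of c B "\<lambda>c. \<bar>a m c - a n c\<bar>"] that insert.hyps by simp
        also have "\<dots> \<le> C' * norm (y m - y n)"
          using C'(1)[of "\<lambda>c. a m c - a n c"] by (simp add: a sum_subtractf algebra_simps)
        also have "\<dots> \<le> (C' + 1) * norm (y m - y n)" by (simp add: algebra_simps)
        also have "\<dots> < e" using M[OF mn] C'(2) by (simp add: field_simps)
        finally show "norm (a m c - a n c) < e" .
      qed
    qed
    then have "\<forall>c\<in>B. \<exists>l. (\<lambda>n. a n c) \<longlonglongrightarrow> l"
      by (auto simp: Cauchy_convergent_iff convergent_def)
    then obtain l where l: "\<And>c. c \<in> B \<Longrightarrow> (\<lambda>n. a n c) \<longlonglongrightarrow> l c" by metis
    have "(\<lambda>n. \<Sum>c\<in>B. a n c *\<^sub>R c) \<longlonglongrightarrow> (\<Sum>c\<in>B. l c *\<^sub>R c)"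
      by (intro tendsto_intros l)
    then have "b = (\<Sum>c\<in>B. l c *\<^sub>R c)"
      using lim LIMSEQ_unique unfolding a[symmetric] by blast
    moreover have "(\<Sum>c\<in>B. l c *\<^sub>R c) \<in> span B" by (intro span_sum span_scale span_base)
    ultimately show False using b by simp
  qed
  then obtain \<epsilon> where \<epsilon>: "\<epsilon> > 0" "\<And>y. y \<in> span B \<Longrightarrow> \<epsilon> \<le> norm (b - y)" by auto
  \<comment> \<open>The distance \<epsilon> of \<open>b\<close> from the span bounds the new
    coefficient by \<open>norm w / \<epsilon>\<close>. The triangle inequality then bounds the
    remaining part by \<open>(1 + norm b / \<epsilon>) * norm w\<close>, and \<open>C'\<close>
    handles its coefficients.\<close>
  have "(\<Sum>c\<in>insert b B. \<bar>a c\<bar>) \<le> (1 / \<epsilon> + C' * (1 + norm b / \<epsilon>)) * norm (\<Sum>c\<in>insert b B. a c *\<^sub>R c)"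
    for a
  proof -
    define z where "z = (\<Sum>c\<in>B. a c *\<^sub>R c)"
    define w where "w = a b *\<^sub>R b + z"
    have z: "z \<in> span B" unfolding z_def by (intro span_sum span_scale span_base)
    have ab: "\<bar>a b\<bar> * \<epsilon> \<le> norm w"
    proof (cases "a b = 0")
      case False
      have "w = a b *\<^sub>R (b - (- (1 / a b)) *\<^sub>R z)"
        using False by (simp add: w_def algebra_simps)
      then have "norm w = \<bar>a b\<bar> * norm (b - (- (1 / a b)) *\<^sub>R z)" by (metis norm_scaleR)
      moreover have "(- (1 / a b)) *\<^sub>R z \<in> span B" using z span_scale by blast
      ultimately show ?thesis using \<epsilon>(2) by (metis abs_ge_zero mult_left_mono)
    qed auto
    then have ab': "\<bar>a b\<bar> \<le> norm w / \<epsilon>" using \<epsilon>(1) by (simp add: field_simps)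
    have "norm z \<le> norm w + \<bar>a b\<bar> * norm b"
      using norm_triangle_ineq4[of w "a b *\<^sub>R b"] by (simp add: w_def)
    also have "\<dots> \<le> norm w + norm w / \<epsilon> * norm b" using mult_right_mono[OF ab' norm_ge_zero[of b]] by simp
    finally have nz: "norm z \<le> (1 + norm b / \<epsilon>) * norm w" by (simp add: algebra_simps)
    have "(\<Sum>c\<in>insert b B. \<bar>a c\<bar>) = \<bar>a b\<bar> + (\<Sum>c\<in>B. \<bar>a c\<bar>)" using insert.hyps by simp
    also have "\<dots> \<le> norm w / \<epsilon> + C' * norm z" using ab' C'(1)[of a] by (simp add: z_def)
    also have "\<dots> \<le> norm w / \<epsilon> + C' * ((1 + norm b / \<epsilon>) * norm w)"
      using mult_left_mono[OF nz C'(2)] by simp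
    finally show ?thesis using insert.hyps by (simp add: w_def z_def algebra_simps)
  qed
  then show ?case by blast
qed

text \<open>Coordinates in a basis are linear; the bound on coefficients makes them continuous. The
  basis is extracted from a finite spanning set, the form in which a manifold supplies finite
  dimension.\<close>

lemma finite_dim_bounded_coordinates:
  fixes S :: "'a::real_normed_vector set"
  assumes "finite S" "span S = UNIV"
  obtains B :: "'a set" and a :: "'a \<Rightarrow> 'a \<Rightarrow> real"
  where "finite B" "\<And>b. b \<in> B \<Longrightarrow> bounded_linear (a b)" "\<And>y. y = (\<Sum>b\<in>B. a b y *\<^sub>R b)"
proof -
  obtain B where B: "B \<subseteq> S" "independent B" "S \<subseteq> span B"
    using maximal_independent_subset by blast
  have fin: "finite B" using B(1) assms(1) finite_subset by blast
  have spanB: "y \<in> span B" for y using B(3) assms(2) span_mono span_span by (metis UNIV_I subsetD)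
  define a where "a b y = representation B y b" for b y
  have rep: "y = (\<Sum>b\<in>B. a b y *\<^sub>R b)" for y
    unfolding a_def using sum_representation_eq[OF B(2) spanB fin order_refl, of y] by simp
  obtain C where C: "\<And>a. (\<Sum>b\<in>B. \<bar>a b\<bar>) \<le> C * norm (\<Sum>b\<in>B. a b *\<^sub>R b)"
    using independent_coefficients_bounded[OF fin B(2)] by blast
  have "bounded_linear (a b)" if "b \<in> B" for b
  proof (rule bounded_linear_intro)
    show "a b (x + y) = a b x + a b y" for x y
      unfolding a_def by (simp add: representation_add[OF B(2) spanB spanB])
    show "a b (r *\<^sub>R x) = r *\<^sub>R a b x" for r x
      unfolding a_def by (simp add: representation_scale[OF B(2) spanB])
    show "norm (a b x) \<le> norm x * C" for x
      using member_le_sum[of b B "\<lambda>b. \<bar>a b x\<bar>"] that fin C[of "\<lambda>b. a b x"] rep[of x]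
      by (simp add: mult.commute)
  qed
  then show ?thesis using that fin rep by blast
qed

text \<open>The derivative \<open>Dg(f x)(Df(x) v)\<close> is expanded in a basis of the middle space, which turns it
  into a finite sum of products of functions to which the induction hypothesis applies.\<close>

lemma Ck_on_compose:
  fixes f :: "'a::real_normed_vector \<Rightarrow> 'b::real_normed_vector" and g :: "'b \<Rightarrow> 'c::real_normed_vector"
  fixes E :: "'b set"
  assumes fd: "finite E" "span E = UNIV"
    and "open S" "open T" "Ck_on k S f" "Ck_on k T g" "f ` S \<subseteq> T"
  shows "Ck_on k S (g \<circ> f)"
proof -
  obtain B :: "'b set" and a where B: "finite B" "\<And>b. b \<in> B \<Longrightarrow> bounded_linear (a b)"
    "\<And>y. y = (\<Sum>b\<in>B. a b y *\<^sub>R b)"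
    using finite_dim_bounded_coordinates[OF fd] by blast
  show ?thesis
    using assms(5,6)
  proof (induction k arbitrary: g)
    case 0
    then show ?case using assms(7) by (simp add: continuous_on_compose2 continuous_on_compose continuous_on_subset)
  next
    case (Suc k)
    have D: "(f has_derivative frechet_derivative f (at x)) (at x)"
      "(g has_derivative frechet_derivative g (at (f x))) (at (f x))" if "x \<in> S" for x
      using Suc.prems that assms(3,4,7)
      by (auto simp: differentiable_on_eq_differentiable_at frechet_derivative_works[symmetric])
    have "Ck_on k S (\<lambda>x. frechet_derivative (g \<circ> f) (at x) v)" for v
    proof (rule Ck_on_cong[OF assms(3)])
      have "Ck_on k S ((\<lambda>y. frechet_derivative g (at y) b) \<circ> f)" for b
        using Suc.prems Ck_on_Suc_imp by (intro Suc.IH) auto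
      then have 1: "Ck_on k S (\<lambda>x. frechet_derivative g (at (f x)) b)" for b
        by (simp add: o_def)
      show "Ck_on k S (\<lambda>x. \<Sum>b\<in>B. a b (frechet_derivative f (at x) v) *\<^sub>R frechet_derivative g (at (f x)) b)"
      proof (intro Ck_on_sum[OF assms(3)] Ck_on_scaleR[OF assms(3)] 1)
        show "Ck_on k S (\<lambda>x. a b (frechet_derivative f (at x) v))" if "b \<in> B" for b
          using Ck_on_bounded_linear[OF assms(3) B(2)[OF that]] Suc.prems(1) by simp
      qed
      show "(\<Sum>b\<in>B. a b (frechet_derivative f (at x) v) *\<^sub>R frechet_derivative g (at (f x)) b) =
        frechet_derivative (g \<circ> f) (at x) v" if x: "x \<in> S" for x
      proof -
        have lin: "linear (frechet_derivative g (at (f x)))"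
          using D(2)[OF x] has_derivative_linear by blast
        have "frechet_derivative (g \<circ> f) (at x) v = frechet_derivative g (at (f x)) (frechet_derivative f (at x) v)"
          using frechet_derivative_at[OF diff_chain_at[OF D[OF x]]] by (metis o_apply)
        also have "\<dots> = frechet_derivative g (at (f x)) (\<Sum>b\<in>B. a b (frechet_derivative f (at x) v) *\<^sub>R b)"
          using B(3) by metis
        finally show ?thesis by (simp add: linear_sum[OF lin] linear_scale[OF lin])
      qed
    qed
    moreover have "(g \<circ> f) differentiable_on S"
      using diff_chain_at[OF D] by (meson differentiableI differentiable_at_imp_differentiable_on)
    ultimately show ?case unfolding Ck_on.simps by blast
  qed
qed

section \<open>Exterior multiplication by a covector\<close>

lemma lin_on_zero: "lin_on V (\<lambda>u. 0)"
  by (simp add: lin_on_def)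

lemma lin_on_diff: "lin_on V f \<Longrightarrow> lin_on V g \<Longrightarrow> lin_on V (\<lambda>u. f u - g u)"
  by (simp add: lin_on_def algebra_simps)

lemma lin_on_add: "lin_on V f \<Longrightarrow> lin_on V g \<Longrightarrow> lin_on V (\<lambda>u. f u + g u)"
  by (simp add: lin_on_def algebra_simps)

lemma lin_on_scaleR: "lin_on V f \<Longrightarrow> lin_on V (\<lambda>u. c *\<^sub>R f u)"
  by (simp add: lin_on_def algebra_simps)

lemma lin_on_scaleR_left: "lin_on V f \<Longrightarrow> lin_on V (\<lambda>u. f u *\<^sub>R c)"
  by (simp add: lin_on_def algebra_simps)

lemma lin_on_sum: "(\<And>i. i \<in> I \<Longrightarrow> lin_on V (f i)) \<Longrightarrow> lin_on V (\<lambda>u. \<Sum>i\<in>I. f i u)"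
  by (induction I rule: infinite_finite_induct) (auto simp: lin_on_zero intro!: lin_on_add)

lemma lin_on_apply_sum:
  assumes "lin_on V f" "subspace V" "finite I" "\<And>i. i \<in> I \<Longrightarrow> v i \<in> V"
  shows "f (\<Sum>i\<in>I. a i *\<^sub>R v i) = (\<Sum>i\<in>I. a i *\<^sub>R f (v i))"
  using assms(3,4)
proof (induction I rule: finite_induct)
  case empty
  have "f (0 *\<^sub>R 0 + 0 *\<^sub>R 0) = 0 *\<^sub>R f 0 + 0 *\<^sub>R f 0"
    using assms(1) subspace_0[OF assms(2)] unfolding lin_on_def by blast
  then show ?case by simp
next
  case (insert i I)
  have "(\<Sum>i\<in>I. a i *\<^sub>R v i) \<in> V"
    using insert.prems by (intro subspace_sum subspace_scale assms(2)) auto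
  then have "f (a i *\<^sub>R v i + 1 *\<^sub>R (\<Sum>i\<in>I. a i *\<^sub>R v i)) =
      a i *\<^sub>R f (v i) + 1 *\<^sub>R f (\<Sum>i\<in>I. a i *\<^sub>R v i)"
    using assms(1) insert.prems unfolding lin_on_def by blast
  then show ?case using insert by simp
qed

lemma lin_on_apply_zero: "lin_on V f \<Longrightarrow> subspace V \<Longrightarrow> f 0 = 0"
  using lin_on_apply_sum[of V f "{}"] by simp

lemma dual_scale:
  assumes "\<phi> \<in> dual V" "v \<in> V"
  shows "\<phi> (a *\<^sub>R v) = a * \<phi> v"
proof -
  have "\<phi> (a *\<^sub>R v + 0 *\<^sub>R v) = a *\<^sub>R \<phi> v + 0 *\<^sub>R \<phi> v"
    using assms unfolding dual_def lin_on_def by blast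
  then show ?thesis by simp
qed

section \<open>Exterior multiplication on argument lists\<close>

lemma del_nth_0 [simp]: "del_nth 0 (v # vs) = vs"
  by (simp add: del_nth_def)

lemma del_nth_Suc [simp]: "del_nth (Suc i) (v # vs) = v # del_nth i vs"
  by (simp add: del_nth_def)

lemma length_del_nth [simp]: "i < length vs \<Longrightarrow> length (del_nth i vs) = length vs - 1"
  by (simp add: del_nth_def)

lemma set_del_nth_subset: "set (del_nth i vs) \<subseteq> set vs"
  by (auto simp: del_nth_def dest: in_set_takeD in_set_dropD)

lemma set_del_nth_insert: "i < length vs \<Longrightarrow> set vs = insert (vs ! i) (set (del_nth i vs))"
  by (subst id_take_nth_drop[of i vs], simp_all add: del_nth_def)

lemma map_del_nth: "map f (del_nth i vs) = del_nth i (map f vs)"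
  by (simp add: del_nth_def take_map drop_map)

lemma wedge_Nil [simp]: "wedge \<xi> \<alpha> [] = 0"
  by (simp add: wedge_def)

text \<open>Contraction with \<open>v\<close> is an antiderivation. The inductions on argument lists
  below run on this identity, and at \<open>\<xi> v = 1\<close> it becomes the homotopy
  formula.\<close>

lemma wedge_Cons: "wedge \<xi> \<alpha> (v # vs) = \<xi> v *\<^sub>R \<alpha> vs - wedge \<xi> (\<lambda>ws. \<alpha> (v # ws)) vs"
  unfolding wedge_def by (simp add: sum.lessThan_Suc_shift sum_negf del: sum.lessThan_Suc)

lemma wedge_lin_right:
  "wedge \<xi> (\<lambda>vs. a *\<^sub>R \<alpha> vs + b *\<^sub>R \<beta> vs) vs = a *\<^sub>R wedge \<xi> \<alpha> vs + b *\<^sub>R wedge \<xi> \<beta> vs"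
  unfolding wedge_def by (simp add: scaleR_right_distrib sum.distrib scaleR_sum_right mult.commute mult.left_commute)

lemma wedge_lin_left: "wedge (a *\<^sub>R \<xi> + b *\<^sub>R \<eta>) \<alpha> = a *\<^sub>R wedge \<xi> \<alpha> + b *\<^sub>R wedge \<eta> \<alpha>"
proof
  show "wedge (a *\<^sub>R \<xi> + b *\<^sub>R \<eta>) \<alpha> vs = (a *\<^sub>R wedge \<xi> \<alpha> + b *\<^sub>R wedge \<eta> \<alpha>) vs" for vs
    by (simp add: wedge_def scaleR_left_distrib distrib_left sum.distrib scaleR_sum_right
        mult.commute mult.left_commute)
qed

lemma wedge_zero: "wedge \<xi> 0 = 0"
  by (simp add: wedge_def fun_eq_iff)

lemma wedge_zero_left: "wedge (\<lambda>v. 0) \<alpha> = 0"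
  by (simp add: wedge_def fun_eq_iff)

text \<open>Holds for arbitrary functions of lists, alternating or not: after two uses of
  \<open>wedge_Cons\<close> the terms \<open>\<xi> v *\<^sub>R wedge \<xi> \<alpha> vs\<close>
  cancel, and the rest is the induction hypothesis for the contracted function.\<close>

lemma wedge_wedge: "wedge \<xi> (wedge \<xi> \<alpha>) vs = 0"
proof (induction vs arbitrary: \<alpha>)
  case (Cons v vs)
  have "wedge \<xi> (\<lambda>ws. wedge \<xi> \<alpha> (v # ws)) vs =
      wedge \<xi> (\<lambda>ws. \<xi> v *\<^sub>R \<alpha> ws + (- 1) *\<^sub>R wedge \<xi> (\<lambda>ws. \<alpha> (v # ws)) ws) vs"
    by (simp add: wedge_Cons)
  also have "\<dots> = \<xi> v *\<^sub>R wedge \<xi> \<alpha> vs"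
    by (simp only: wedge_lin_right Cons.IH) simp
  finally show ?case by (simp add: wedge_Cons[of \<xi> "wedge \<xi> \<alpha>"])
qed simp

section \<open>Alternating forms with values in a subspace\<close>

lemma alt_formsI:
  assumes "\<And>vs. length vs = p \<Longrightarrow> set vs \<subseteq> V \<Longrightarrow> \<alpha> vs \<in> W"
    and "\<And>vs i. length vs = p \<Longrightarrow> set vs \<subseteq> V \<Longrightarrow> i < p \<Longrightarrow> lin_on V (\<lambda>u. \<alpha> (vs[i := u]))"
    and "\<And>vs. length vs = p \<Longrightarrow> set vs \<subseteq> V \<Longrightarrow> \<not> distinct vs \<Longrightarrow> \<alpha> vs = 0"
    and "\<And>vs. \<not> (length vs = p \<and> set vs \<subseteq> V) \<Longrightarrow> \<alpha> vs = 0"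
  shows "\<alpha> \<in> alt_forms p V W"
  using assms unfolding alt_forms_def by simp

lemma
  assumes "\<alpha> \<in> alt_forms p V W"
  shows alt_forms_mem: "length vs = p \<Longrightarrow> set vs \<subseteq> V \<Longrightarrow> \<alpha> vs \<in> W"
    and alt_forms_lin: "length vs = p \<Longrightarrow> set vs \<subseteq> V \<Longrightarrow> i < p \<Longrightarrow> lin_on V (\<lambda>u. \<alpha> (vs[i := u]))"
    and alt_forms_not_distinct: "length vs = p \<Longrightarrow> set vs \<subseteq> V \<Longrightarrow> \<not> distinct vs \<Longrightarrow> \<alpha> vs = 0"
    and alt_forms_outside: "\<not> (length vs = p \<and> set vs \<subseteq> V) \<Longrightarrow> \<alpha> vs = 0"
  using assms unfolding alt_forms_def by auto

lemma alt_forms_eqI: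
  assumes "\<alpha> \<in> alt_forms p V W" "\<beta> \<in> alt_forms p V W'"
    and "\<And>vs. length vs = p \<Longrightarrow> set vs \<subseteq> V \<Longrightarrow> \<alpha> vs = \<beta> vs"
  shows "\<alpha> = \<beta>"
proof
  show "\<alpha> vs = \<beta> vs" for vs
    using assms(3) alt_forms_outside[OF assms(1), of vs] alt_forms_outside[OF assms(2), of vs] by metis
qed

lemma alt_forms_contract:
  assumes "\<alpha> \<in> alt_forms (Suc p) V W" "v \<in> V"
  shows "(\<lambda>vs. \<alpha> (v # vs)) \<in> alt_forms p V W"
proof (rule alt_formsI)
  fix vs i assume "length vs = p" "set vs \<subseteq> V" "i < p"
  then show "lin_on V (\<lambda>u. \<alpha> (v # vs[i := u]))"
    using alt_forms_lin[OF assms(1), of "v # vs" "Suc i"] assms(2) by simp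
next
  fix vs assume "\<not> (length vs = p \<and> set vs \<subseteq> V)"
  then show "\<alpha> (v # vs) = 0" using alt_forms_outside[OF assms(1), of "v # vs"] by simp
qed (use alt_forms_mem[OF assms(1)] alt_forms_not_distinct[OF assms(1)] assms(2) in auto)

lemma alt_forms_lin_first:
  assumes "\<alpha> \<in> alt_forms (Suc p) V W" "length vs = p" "set vs \<subseteq> V"
  shows "lin_on V (\<lambda>u. \<alpha> (u # vs))"
\<comment> \<open>\<open>alt_forms_lin\<close> updates a complete argument list, so some vector of
  \<open>V\<close> must first fill the slot.\<close>
proof (cases "V = {}")
  case False
  then obtain v where "v \<in> V" by blast
  then show ?thesis using alt_forms_lin[OF assms(1), of "v # vs" 0] assms(2,3) by simp
qed (simp add: lin_on_def)

lemma alt_forms_lin_second: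
  assumes "\<alpha> \<in> alt_forms (Suc (Suc p)) V W" "length vs = p" "set vs \<subseteq> V" "v \<in> V"
  shows "lin_on V (\<lambda>u. \<alpha> (v # u # vs))"
  using alt_forms_lin[OF assms(1), of "v # v # vs" 1] assms(2-) by simp

text \<open>Polarization: expand \<alpha> with \<open>u + v\<close> in both of the first two
  slots.\<close>

lemma alt_forms_swap:
  assumes \<alpha>: "\<alpha> \<in> alt_forms (Suc (Suc p)) V W" and "subspace V"
    and vs: "length vs = p" "set vs \<subseteq> V" and u: "u \<in> V" and v: "v \<in> V"
  shows "\<alpha> (v # u # vs) = - \<alpha> (u # v # vs)"
proof -
  have add1: "\<alpha> ((x + y) # z # vs) = \<alpha> (x # z # vs) + \<alpha> (y # z # vs)"
    if "x \<in> V" "y \<in> V" "z \<in> V" for x y z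
    using alt_forms_lin_first[OF \<alpha>, of "z # vs"] that vs unfolding lin_on_def
    by (metis length_Cons list.simps(15) insert_subset scaleR_one)
  have add2: "\<alpha> (z # (x + y) # vs) = \<alpha> (z # x # vs) + \<alpha> (z # y # vs)"
    if "x \<in> V" "y \<in> V" "z \<in> V" for x y z
    using alt_forms_lin_second[OF \<alpha> vs that(3)] that unfolding lin_on_def
    by (metis scaleR_one)
  have same: "\<alpha> (x # x # vs) = 0" if "x \<in> V" for x
    using alt_forms_not_distinct[OF \<alpha>, of "x # x # vs"] that vs by simp
  have uv: "u + v \<in> V" using assms(2) u v by (rule subspace_add)
  have "0 = \<alpha> ((u + v) # (u + v) # vs)" using same[OF uv] by simp
  also have "\<dots> = \<alpha> (u # v # vs) + \<alpha> (v # u # vs)"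
    using add1[OF u v uv] add2[OF u v u] add2[OF u v v] same[OF u] same[OF v] by simp
  finally show ?thesis by (simp add: eq_neg_iff_add_eq_0 add.commute)
qed

lemma subspace_alt_forms:
  assumes "subspace W"
  shows "subspace (alt_forms p V W)"
proof (rule subspaceI)
  show "0 \<in> alt_forms p V W"
    by (rule alt_formsI) (simp_all add: lin_on_zero subspace_0[OF assms])
next
  fix \<alpha> \<beta> assume ab: "\<alpha> \<in> alt_forms p V W" "\<beta> \<in> alt_forms p V W"
  show "\<alpha> + \<beta> \<in> alt_forms p V W"
    by (rule alt_formsI)
      (simp_all add: lin_on_add alt_forms_lin[OF ab(1)] alt_forms_lin[OF ab(2)]
        alt_forms_not_distinct[OF ab(1)] alt_forms_not_distinct[OF ab(2)]
        alt_forms_outside[OF ab(1)] alt_forms_outside[OF ab(2)]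
        subspace_add[OF assms] alt_forms_mem[OF ab(1)] alt_forms_mem[OF ab(2)])
next
  fix \<alpha> c assume a: "\<alpha> \<in> alt_forms p V W"
  show "c *\<^sub>R \<alpha> \<in> alt_forms p V W"
    by (rule alt_formsI)
      (simp_all add: lin_on_scaleR alt_forms_lin[OF a] alt_forms_not_distinct[OF a]
        alt_forms_outside[OF a] subspace_scale[OF assms] alt_forms_mem[OF a])
qed

text \<open>Linearity and alternation go by induction on the degree, peeling off the first argument
  with \<open>wedge_Cons\<close>; the remaining term is the wedge of \<xi> with a contraction, a
  form of lower degree.\<close>

lemma wedge_alt_forms:
  assumes V: "subspace V" and W: "subspace W" and \<xi>: "\<xi> \<in> dual V" and \<alpha>: "\<alpha> \<in> alt_forms p V W"
  shows "wedge \<xi> \<alpha> \<in> alt_forms (Suc p) V W"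
proof (rule alt_formsI)
  fix vs :: "'a list" assume vs: "length vs = Suc p" "set vs \<subseteq> V"
  show "wedge \<xi> \<alpha> vs \<in> W"
    unfolding wedge_def
    using vs set_del_nth_subset[of _ vs]
    by (intro subspace_sum[OF W] subspace_scale[OF W] alt_forms_mem[OF \<alpha>]) auto
next
  fix vs :: "'a list" and i assume "length vs = Suc p" "set vs \<subseteq> V" "i < Suc p"
  then show "lin_on V (\<lambda>u. wedge \<xi> \<alpha> (vs[i := u]))"
    using \<alpha>
  proof (induction p arbitrary: \<alpha> vs i)
    case 0
    then obtain v where "vs = [v]" "i = 0" by (auto simp: length_Suc_conv)
    then show ?case using \<xi> by (simp add: wedge_Cons lin_on_scaleR_left dual_def)
  next
    case (Suc p)
    then obtain v ws where vs: "vs = v # ws" "length ws = Suc p" "v \<in> V" "set ws \<subseteq> V"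
      by (auto simp: length_Suc_conv)
    show ?case
    proof (cases i)
      case 0
      have "lin_on V (\<lambda>u. wedge \<xi> (\<lambda>ws. \<alpha> (u # ws)) ws)"
        unfolding wedge_def
        using vs set_del_nth_subset[of _ ws]
        by (intro lin_on_sum lin_on_scaleR alt_forms_lin_first[OF Suc.prems(4)]) auto
      then show ?thesis
        using \<xi> by (auto simp: 0 vs(1) wedge_Cons dual_def intro!: lin_on_diff lin_on_scaleR_left)
    next
      case (Suc j)
      then have "j < Suc p" using Suc.prems by simp
      then show ?thesis
        using Suc.IH[OF vs(2,4) _ alt_forms_contract[OF Suc.prems(4) vs(3)]] vs
          alt_forms_lin[OF Suc.prems(4) vs(2,4)]
        by (auto simp: Suc wedge_Cons intro!: lin_on_diff lin_on_scaleR)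
    qed
  qed
next
  fix vs :: "'a list" assume "length vs = Suc p" "set vs \<subseteq> V" "\<not> distinct vs"
  then show "wedge \<xi> \<alpha> vs = 0"
    using \<alpha>
  proof (induction p arbitrary: \<alpha> vs)
    case 0
    then show ?case by (auto simp: length_Suc_conv)
  next
    case (Suc p)
    note \<alpha> = Suc.prems(4)
    obtain v w ws where vs: "vs = v # w # ws" "length ws = p" "v \<in> V" "w \<in> V" "set ws \<subseteq> V"
      using Suc.prems by (auto simp: length_Suc_conv)
    have tail: "wedge \<xi> \<alpha> (x # y # ws) = 0" if "\<not> distinct (y # ws)" "x \<in> V" "y \<in> V" for x y
      using Suc.IH[OF _ _ that(1) alt_forms_contract[OF \<alpha> that(2)]] that vs
        alt_forms_not_distinct[OF \<alpha>, of "y # ws"]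
      by (simp add: wedge_Cons)
    have expand: "wedge \<xi> \<alpha> (x # y # ws) = \<xi> x *\<^sub>R \<alpha> (y # ws) - \<xi> y *\<^sub>R \<alpha> (x # ws)
        + wedge \<xi> (\<lambda>ws. \<alpha> (x # y # ws)) ws" for x y
      by (simp add: wedge_Cons)
    \<comment> \<open>The sign changes termwise. A summand has lost one entry of \<open>ws\<close>,
      so the exchange takes place with \<open>q\<close>, one less than \<open>p\<close>, further
      arguments.\<close>
    have swap: "wedge \<xi> (\<lambda>ws. \<alpha> (v # w # ws)) ws = - wedge \<xi> (\<lambda>ws. \<alpha> (w # v # ws)) ws"
      unfolding wedge_def sum_negf[symmetric]
    proof (rule sum.cong[OF refl])
      fix i assume i: "i \<in> {..<length ws}"
      then obtain q where q: "p = Suc q" "length (del_nth i ws) = q" using vs(2) by (cases p) auto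
      have "\<alpha> (v # w # del_nth i ws) = - \<alpha> (w # v # del_nth i ws)"
        using alt_forms_swap[OF \<alpha>[unfolded q(1)] V q(2) _ vs(4,3)] set_del_nth_subset[of i ws] vs(5)
        by auto
      then show "((- 1) ^ i * \<xi> (ws ! i)) *\<^sub>R \<alpha> (v # w # del_nth i ws) =
          - (((- 1) ^ i * \<xi> (ws ! i)) *\<^sub>R \<alpha> (w # v # del_nth i ws))"
        by simp
    qed
    \<comment> \<open>The repetition lies in the tail, in the first two places, or between the first
      place and \<open>ws\<close>. In the last case exchanging \<open>v\<close> and \<open>w\<close>
      moves it into the tail.\<close>
    consider "\<not> distinct (w # ws)" | "v = w" | "v \<in> set ws" using Suc.prems(3) vs(1) by auto
    then show ?case
    proof cases
      case 1
      then show ?thesis using tail vs by simp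
    next
      case 2
      then have "wedge \<xi> (\<lambda>ws. \<alpha> (v # w # ws)) ws = 0" using swap by (simp add: eq_neg_iff_add_eq_0 scaleR_2[symmetric])
      then show ?thesis using 2 expand[of v w] vs(1) by simp
    next
      case 3
      then have "wedge \<xi> \<alpha> (w # v # ws) = 0" using tail vs by simp
      moreover have "wedge \<xi> \<alpha> (v # w # ws) = - wedge \<xi> \<alpha> (w # v # ws)"
        by (simp only: expand swap) simp
      ultimately show ?thesis using vs(1) by simp
    qed
  qed
next
  fix vs :: "'a list" assume vs: "\<not> (length vs = Suc p \<and> set vs \<subseteq> V)"
  \<comment> \<open>Deleting an entry can bring the list into the domain of \<alpha> only if that
    entry lies outside \<open>V\<close>, where \<xi> is 0 as an element of
    \<open>dual V\<close>.\<close>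
  have "((- 1) ^ i * \<xi> (vs ! i)) *\<^sub>R \<alpha> (del_nth i vs) = 0" if "i < length vs" for i
  proof (cases "length (del_nth i vs) = p \<and> set (del_nth i vs) \<subseteq> V")
    case True
    then have "vs ! i \<notin> V" using vs that set_del_nth_insert[OF that] by auto
    then show ?thesis using \<xi> by (simp add: dual_def)
  qed (simp add: alt_forms_outside[OF \<alpha>])
  then show "wedge \<xi> \<alpha> vs = 0" unfolding wedge_def by (intro sum.neutral) simp
qed

section \<open>Exactness of exterior multiplication by a nonzero covector\<close>

lemma lin_on_wedge: "lin_on E (wedge \<xi>)"
  by (simp add: lin_on_def fun_eq_iff plus_fun_def scaleR_fun_def wedge_lin_right)

text \<open>Contraction with a vector \<open>v\<close> such that \<open>\<xi> v = 1\<close> is a contracting homotopy.\<close>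

lemma wedge_kernel:
  assumes V: "subspace V" and W: "subspace W" and \<xi>: "\<xi> \<in> dual V" "\<xi> \<noteq> 0"
  shows "{\<alpha> \<in> alt_forms p V W. wedge \<xi> \<alpha> = 0} =
      (if p = 0 then {0} else wedge \<xi> ` alt_forms (p - 1) V W)"
proof -
  obtain u where u: "\<xi> u \<noteq> 0" using \<xi>(2) by (auto simp: fun_eq_iff)
  then have uV: "u \<in> V" using \<xi>(1) by (auto simp: dual_def)
  define v where "v = (1 / \<xi> u) *\<^sub>R u"
  have v: "v \<in> V" "\<xi> v = 1"
    using uV u dual_scale[OF \<xi>(1) uV] subspace_scale[OF V] by (auto simp: v_def)
  have homotopy: "\<alpha> = wedge \<xi> (\<lambda>vs. \<alpha> (v # vs))" if "wedge \<xi> \<alpha> = 0" for \<alpha> :: "'a list \<Rightarrow> 'b"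
  proof
    show "\<alpha> vs = wedge \<xi> (\<lambda>vs. \<alpha> (v # vs)) vs" for vs
      using fun_cong[OF that, of "v # vs"] v(2) by (simp add: wedge_Cons)
  qed
  show ?thesis
  proof (cases p)
    case 0
    have "\<alpha> = 0" if \<alpha>: "\<alpha> \<in> alt_forms 0 V W" "wedge \<xi> \<alpha> = 0" for \<alpha>
    proof -
      \<comment> \<open>A 0-form has the default value 0 on nonempty lists, so its contraction
        vanishes and the homotopy formula leaves only 0.\<close>
      have "(\<lambda>vs. \<alpha> (v # vs)) = 0" using alt_forms_outside[OF \<alpha>(1)] by (auto simp: fun_eq_iff)
      then show ?thesis using homotopy[OF \<alpha>(2)] wedge_zero by metis
    qed
    moreover have "0 \<in> alt_forms 0 V W" using subspace_alt_forms[OF W] subspace_0 by blast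
    ultimately show ?thesis using 0 wedge_zero by auto
  next
    case (Suc q)
    have "\<alpha> \<in> wedge \<xi> ` alt_forms q V W" if "\<alpha> \<in> alt_forms p V W" "wedge \<xi> \<alpha> = 0" for \<alpha>
      using homotopy[OF that(2)] alt_forms_contract[of \<alpha> q V W v] that(1) v(1) Suc by blast
    moreover have "wedge \<xi> (wedge \<xi> \<beta>) = 0" for \<beta> :: "'a list \<Rightarrow> 'b"
      by (simp add: fun_eq_iff wedge_wedge)
    ultimately show ?thesis using wedge_alt_forms[OF V W \<xi>(1), of _ q] Suc by auto
  qed
qed

text \<open>More than \<open>dim\<close> many vectors satisfy a linear relation with a nonzero
  coefficient at some \<open>v\<close>. Put into the slot of \<open>v\<close>, it kills every term
  but that of \<open>v\<close>, because the other vectors already occur among the arguments. The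
  relation is found among the images under \<open>L\<close>, since dimension is known for the model
  space and not for \<open>V\<close>.\<close>

lemma alt_forms_above_dim:
  fixes L :: "'a::real_vector \<Rightarrow> 'e::real_vector" and S :: "'e set"
  assumes V: "subspace V" and L: "lin_on V L" "inj_on L V"
    and S: "finite S" "span S = UNIV" and p: "dim (UNIV :: 'e set) < p"
    and \<alpha>: "\<alpha> \<in> alt_forms p V W"
  shows "\<alpha> = 0"
proof
  fix vs
  have "\<alpha> vs = 0" if vs: "length vs = p" "set vs \<subseteq> V" and dist: "distinct vs"
  proof -
    obtain B :: "'e set" where B: "independent B" "UNIV \<subseteq> span B" "card B = dim (UNIV :: 'e set)"
      using basis_exists[of "UNIV :: 'e set"] by metis
    have finB: "finite B" using independent_span_bound[OF S(1) B(1)] S(2) by simp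
    have inj: "inj_on L (set vs)" using L(2) vs(2) inj_on_subset by blast
    have card: "card (L ` set vs) = p" using card_image[OF inj] distinct_card[OF dist] vs(1) by simp
    have "dependent (L ` set vs)"
      using independent_span_bound[OF finB, of "L ` set vs"] B(2,3) card p by fastforce
    then obtain c where c: "\<exists>y\<in>L ` set vs. c y \<noteq> 0" "(\<Sum>y\<in>L ` set vs. c y *\<^sub>R y) = 0"
      using dependent_finite[of "L ` set vs"] by auto
    then obtain v where v: "v \<in> set vs" "c (L v) \<noteq> 0" by blast
    have mem: "(\<Sum>v\<in>set vs. c (L v) *\<^sub>R v) \<in> V"
      using vs(2) by (intro subspace_sum[OF V] subspace_scale[OF V]) auto
    have "L (\<Sum>v\<in>set vs. c (L v) *\<^sub>R v) = (\<Sum>v\<in>set vs. c (L v) *\<^sub>R L v)"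
      using vs(2) by (intro lin_on_apply_sum[OF L(1) V]) auto
    also have "\<dots> = L 0" using c(2) lin_on_apply_zero[OF L(1) V] by (simp add: sum.reindex[OF inj])
    finally have zero: "(\<Sum>v\<in>set vs. c (L v) *\<^sub>R v) = 0"
      using L(2) mem subspace_0[OF V] by (auto dest: inj_onD)
    obtain i where i: "i < p" "vs ! i = v" using v(1) vs(1) by (auto simp: in_set_conv_nth)
    define f where "f u = \<alpha> (vs[i := u])" for u
    have f: "lin_on V f" using alt_forms_lin[OF \<alpha> vs i(1)] by (simp add: f_def[abs_def])
    have f0: "f w = 0" if w: "w \<in> set vs" "w \<noteq> v" for w
    proof -
      obtain j where j: "j < p" "vs ! j = w" using w(1) vs(1) by (auto simp: in_set_conv_nth)
      then have "i \<noteq> j" using i w(2) by auto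
      then have "vs[i := w] ! i = vs[i := w] ! j" using i j vs(1) by simp
      then have "\<not> distinct (vs[i := w])"
        using i j vs(1) \<open>i \<noteq> j\<close> by (metis length_list_update nth_eq_iff_index_eq)
      moreover have "set (vs[i := w]) \<subseteq> V"
        using vs(2) w(1) set_update_subset_insert[of vs i w] by auto
      ultimately show ?thesis using alt_forms_not_distinct[OF \<alpha>] vs(1) by (simp add: f_def)
    qed
    have "0 = f (\<Sum>v\<in>set vs. c (L v) *\<^sub>R v)" using zero lin_on_apply_zero[OF f V] by simp
    also have "\<dots> = (\<Sum>v\<in>set vs. c (L v) *\<^sub>R f v)"
      using vs(2) by (intro lin_on_apply_sum[OF f V]) auto
    also have "\<dots> = (\<Sum>w\<in>{v}. c (L w) *\<^sub>R f w)"
      using v(1) f0 by (intro sum.mono_neutral_right) auto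
    finally have "f v = 0" using v(2) by simp
    then show ?thesis using i by (metis f_def list_update_id)
  qed
  then show "\<alpha> vs = 0 vs"
    using alt_forms_outside[OF \<alpha>, of vs] alt_forms_not_distinct[OF \<alpha>, of vs] by auto
qed

text \<open>In degree \<open>n\<close> the sequence ends, so no kernel condition is imposed there.
  It holds anyway, because the product with \<xi> is a form of degree \<open>n + 1\<close> and hence
  0; thus \<open>wedge_kernel\<close> covers the last place too.\<close>

lemma wedge_exact_seq_upto:
  fixes L :: "'a::real_vector \<Rightarrow> 'e::real_vector" and S :: "'e set"
  assumes "subspace V" "subspace W" "lin_on V L" "inj_on L V" "finite S" "span S = UNIV"
    and "\<xi> \<in> dual V" "\<xi> \<noteq> 0"
  shows "exact_seq_upto (dim (UNIV :: 'e set)) (\<lambda>p. alt_forms p V W) (\<lambda>p. wedge \<xi>)"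
proof -
  let ?n = "dim (UNIV :: 'e set)"
  have top: "wedge \<xi> \<alpha> = 0" if "\<alpha> \<in> alt_forms p V W" "\<not> p < ?n" for \<alpha> p
    using that alt_forms_above_dim[OF assms(1,3-6), of "Suc p"]
      wedge_alt_forms[OF assms(1,2,7)] by auto
  have "{\<alpha> \<in> alt_forms p V W. p < ?n \<longrightarrow> wedge \<xi> \<alpha> = 0} =
      {\<alpha> \<in> alt_forms p V W. wedge \<xi> \<alpha> = 0}" for p
    using top[of _ p] by auto
  then show ?thesis
    unfolding exact_seq_upto_def wedge_kernel[OF assms(1,2,7,8)]
    using wedge_alt_forms[OF assms(1,2,7)] wedge_kernel[OF assms(1,2,7,8)] by auto
qed

section \<open>Symmetric powers as coefficient spaces\<close>

lemma subspace_sym_pow: "subspace (sym_pow q V)"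
  by (simp add: sym_pow_def)

lemma subspace_sym_alg: "subspace (sym_alg V)"
  by (simp add: sym_alg_def)

text \<open>Reduces equality of two elements of a symmetric power to their values on the dual space.
  The generators vanish elsewhere by definition, hence so does their span.\<close>

lemma sym_pow_outside:
  assumes "F \<in> sym_pow q V" "\<phi> \<notin> dual V"
  shows "F \<phi> = 0"
  using assms(1) unfolding sym_pow_def
proof (induction rule: span_induct_alt)
  case (step c x y)
  then show ?case using assms(2) by auto
qed simp

section \<open>Manifolds and tangent spaces\<close>

lemma smooth_on_cong:
  "open S \<Longrightarrow> (\<And>x. x \<in> S \<Longrightarrow> f x = g x) \<Longrightarrow> smooth_on S f \<Longrightarrow> smooth_on S g"
  unfolding smooth_on_def using Ck_on_cong by blast

lemma smooth_on_subset: "smooth_on S f \<Longrightarrow> T \<subseteq> S \<Longrightarrow> smooth_on T f"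
  unfolding smooth_on_def using Ck_on_subset by blast

lemma smooth_on_local:
  "(\<And>x. x \<in> S \<Longrightarrow> \<exists>T. open T \<and> x \<in> T \<and> smooth_on T f) \<Longrightarrow> smooth_on S f"
  unfolding smooth_on_def using Ck_on_local by metis

lemma smooth_on_frechet_derivative:
  "smooth_on S f \<Longrightarrow> smooth_on S (\<lambda>x. frechet_derivative f (at x) v)"
  unfolding smooth_on_def by (metis Ck_on.simps(2))

lemma smooth_on_differentiable:
  "smooth_on S f \<Longrightarrow> open S \<Longrightarrow> x \<in> S \<Longrightarrow> f differentiable at x"
  unfolding smooth_on_def by (metis Ck_on.simps(2) differentiable_on_eq_differentiable_at)

lemma smooth_on_add:
  "open S \<Longrightarrow> smooth_on S f \<Longrightarrow> smooth_on S g \<Longrightarrow> smooth_on S (\<lambda>x. f x + g x)"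
  unfolding smooth_on_def using Ck_on_add by blast

lemma smooth_on_scaleR:
  fixes f :: "'a::real_normed_vector \<Rightarrow> real"
  shows "open S \<Longrightarrow> smooth_on S f \<Longrightarrow> smooth_on S g \<Longrightarrow> smooth_on S (\<lambda>x. f x *\<^sub>R g x)"
  unfolding smooth_on_def using Ck_on_scaleR by blast

lemma smooth_on_compose:
  fixes f :: "'a::real_normed_vector \<Rightarrow> 'b::real_normed_vector" and E :: "'b set"
  assumes "finite E" "span E = UNIV" "open S" "open T" "smooth_on S f" "smooth_on T g" "f ` S \<subseteq> T"
  shows "smooth_on S (g \<circ> f)"
  using assms Ck_on_compose[OF assms(1-4)] unfolding smooth_on_def by blast

section \<open>Charts, coordinate changes and tangent vectors\<close>

lemma tspace_transition:
  assumes "v \<in> tspace A x" "c \<in> A" "c' \<in> A" "x \<in> fst c" "x \<in> fst c'"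
  shows "v c' = frechet_derivative (snd c' \<circ> chart_inv c) (at (snd c x)) (v c)"
  using assms unfolding tspace_def by blast

lemma tspace_outside: "v \<in> tspace A x \<Longrightarrow> \<not> (c \<in> A \<and> x \<in> fst c) \<Longrightarrow> v c = 0"
  unfolding tspace_def by blast

text \<open>Coordinate expressions agree with compositions only near a point, because a chart and
  its inverse cancel only on the chart domain.\<close>

lemma frechet_derivative_compose_local:
  assumes "f differentiable at x" "f x = z" "g differentiable at z"
    and "open S" "x \<in> S" "\<And>y. y \<in> S \<Longrightarrow> h y = g (f y)"
  shows "h differentiable at x"
    and "frechet_derivative h (at x) v = frechet_derivative g (at z) (frechet_derivative f (at x) v)"
proof -
  have "((g \<circ> f) has_derivative (frechet_derivative g (at (f x)) \<circ> frechet_derivative f (at x))) (at x)"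
    using assms(1-3) by (intro diff_chain_at) (simp_all add: frechet_derivative_works[symmetric])
  then have D: "(h has_derivative (frechet_derivative g (at z) \<circ> frechet_derivative f (at x))) (at x)"
    using assms(2,4-) has_derivative_transform_within_open[of "g \<circ> f" _ x UNIV S h] by simp
  then show "h differentiable at x" by (rule differentiableI)
  show "frechet_derivative h (at x) v = frechet_derivative g (at z) (frechet_derivative f (at x) v)"
    using frechet_derivative_at[OF D] by (metis o_apply)
qed

locale manifold =
  fixes A :: "('m::{t2_space, second_countable_topology}, 'e::real_normed_vector) chart set"
  assumes manifold: "smooth_manifold A"
begin

lemma finite_dim: obtains E :: "'e set" where "finite E" "span E = UNIV"
  using manifold unfolding smooth_manifold_def by blast

lemma chart_at: obtains c where "c \<in> A" "x \<in> fst c"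
  using manifold unfolding smooth_manifold_def by blast

lemma
  assumes "c \<in> A"
  shows chart_open: "open (fst c)"
    and chart_range_open: "open (snd c ` fst c)"
    and chart_homeomorphism: "homeomorphism (fst c) (snd c ` fst c) (snd c) (chart_inv c)"
  using manifold assms unfolding smooth_manifold_def by auto

lemma chart_inv_chart [simp]: "c \<in> A \<Longrightarrow> x \<in> fst c \<Longrightarrow> chart_inv c (snd c x) = x"
  using chart_homeomorphism unfolding homeomorphism_def by blast

lemma chart_image_open:
  assumes "c \<in> A" "open W"
  shows "open (snd c ` (fst c \<inter> W))"
proof -
  have "snd c ` (fst c \<inter> W) = snd c ` fst c \<inter> chart_inv c -` W"
    using assms(1) by (auto simp: image_iff)
  moreover have "open (snd c ` fst c \<inter> chart_inv c -` W)"
    using chart_homeomorphism[OF assms(1)] chart_range_open[OF assms(1)] assms(2)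
    unfolding homeomorphism_def by (metis continuous_open_preimage)
  ultimately show ?thesis by simp
qed

lemma transition_smooth:
  "c \<in> A \<Longrightarrow> c' \<in> A \<Longrightarrow> smooth_on (snd c ` (fst c \<inter> fst c')) (snd c' \<circ> chart_inv c)"
  using manifold unfolding smooth_manifold_def by blast

lemma transition_differentiable:
  assumes "c \<in> A" "c' \<in> A" "x \<in> fst c" "x \<in> fst c'"
  shows "(snd c' \<circ> chart_inv c) differentiable at (snd c x)"
  using assms by (intro smooth_on_differentiable[OF transition_smooth chart_image_open] chart_open) auto

text \<open>Cocycle rule, from the chain rule on the triple overlap. It is what makes a family of
  coordinate vectors obtained from one chart a tangent vector.\<close>

lemma transition_chain:
  assumes "c \<in> A" "c1 \<in> A" "c2 \<in> A" "x \<in> fst c" "x \<in> fst c1" "x \<in> fst c2"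
  shows "frechet_derivative (snd c2 \<circ> chart_inv c) (at (snd c x)) v =
    frechet_derivative (snd c2 \<circ> chart_inv c1) (at (snd c1 x))
      (frechet_derivative (snd c1 \<circ> chart_inv c) (at (snd c x)) v)"
proof -
  define S where "S = snd c ` (fst c \<inter> (fst c1 \<inter> fst c2))"
  have S: "open S" "snd c x \<in> S"
    using assms unfolding S_def by (auto intro!: chart_image_open open_Int chart_open)
  have "(snd c2 \<circ> chart_inv c) y = (snd c2 \<circ> chart_inv c1) ((snd c1 \<circ> chart_inv c) y)" if "y \<in> S" for y
    using that assms by (auto simp: S_def)
  then show ?thesis
    using assms by (intro frechet_derivative_compose_local(2)[OF _ _ _ S] transition_differentiable) simp_all
qed

lemma subspace_tspace: "subspace (tspace A x)"
proof -
  have lin: "linear (frechet_derivative (snd c' \<circ> chart_inv c) (at (snd c x)))"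
    if "c \<in> A" "c' \<in> A" "x \<in> fst c" "x \<in> fst c'" for c c'
    using linear_frechet_derivative[OF transition_differentiable[OF that]] .
  show ?thesis
    unfolding tspace_def
  proof (intro subspaceI CollectI conjI ballI allI impI, goal_cases)
    case (1 c c')
    then show ?case using linear_0[OF lin[of c c']] by simp
  next
    case (3 u v c c')
    then have "w c' = frechet_derivative (snd c' \<circ> chart_inv c) (at (snd c x)) (w c)" if "w \<in> {u, v}" for w
      using that by blast
    then show ?case using linear_add[OF lin[of c c']] 3(3-) by simp
  next
    case (5 a u c c')
    then have "u c' = frechet_derivative (snd c' \<circ> chart_inv c) (at (snd c x)) (u c)" by blast
    then show ?case using linear_scale[OF lin[of c c']] 5(2-) by simp
  qed auto
qed

text \<open>The transformation rule recovers all coordinates from those in \<open>c\<close>. The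
  resulting injection into the model space serves as \<open>L\<close> in the dimension
  count.\<close>

lemma tspace_inj:
  assumes "c \<in> A" "x \<in> fst c"
  shows "inj_on (\<lambda>v. v c) (tspace A x)"
proof (rule inj_onI)
  fix u v assume uv: "u \<in> tspace A x" "v \<in> tspace A x" "u c = v c"
  show "u = v"
  proof
    show "u c' = v c'" for c'
      using tspace_transition[OF uv(1) assms(1) _ assms(2)] tspace_transition[OF uv(2) assms(1) _ assms(2)]
        tspace_outside[OF uv(1)] tspace_outside[OF uv(2)] uv(3)
      by metis
  qed
qed

section \<open>Smooth functions and directional derivatives\<close>

lemma smooth_fun_on_differentiable:
  assumes "smooth_fun_on A W f" "open W" "x \<in> W" "c \<in> A" "x \<in> fst c"
  shows "(f \<circ> chart_inv c) differentiable at (snd c x)"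
  using assms unfolding smooth_fun_on_def
  by (intro smooth_on_differentiable[OF _ chart_image_open[of c W]]) auto

lemma smooth_fun_on_subset:
  "smooth_fun_on A W f \<Longrightarrow> V \<subseteq> W \<Longrightarrow> smooth_fun_on A V f"
  unfolding smooth_fun_on_def
  using smooth_on_subset[OF _ image_mono[OF Int_mono[OF order_refl]]] by blast

lemma smooth_fun_on_const: "smooth_fun_on A W (\<lambda>x. a)"
  by (simp add: smooth_fun_on_def smooth_on_def Ck_on_const comp_def)

lemma smooth_fun_on_add:
  assumes "open W" "smooth_fun_on A W f" "smooth_fun_on A W g"
  shows "smooth_fun_on A W (\<lambda>x. f x + g x)"
  unfolding smooth_fun_on_def
proof
  fix c assume c: "c \<in> A"
  show "smooth_on (snd c ` (fst c \<inter> W)) ((\<lambda>x. f x + g x) \<circ> chart_inv c)"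
    using smooth_on_add[OF chart_image_open[OF c assms(1)], of "f \<circ> chart_inv c" "g \<circ> chart_inv c"]
      assms(2,3) c
    by (simp add: smooth_fun_on_def comp_def)
qed

lemma smooth_fun_on_scaleR:
  assumes "open W" "smooth_fun_on A W f" "smooth_fun_on A W g"
  shows "smooth_fun_on A W (\<lambda>x. f x *\<^sub>R g x)"
  unfolding smooth_fun_on_def
proof
  fix c assume c: "c \<in> A"
  show "smooth_on (snd c ` (fst c \<inter> W)) ((\<lambda>x. f x *\<^sub>R g x) \<circ> chart_inv c)"
    using smooth_on_scaleR[OF chart_image_open[OF c assms(1)], of "f \<circ> chart_inv c" "g \<circ> chart_inv c"]
      assms(2,3) c
    by (simp add: smooth_fun_on_def comp_def)
qed

text \<open>\<open>dirder\<close> computes in a chart picked by \<open>SOME\<close>; proofs about it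
  begin by naming that chart.\<close>

lemma some_chart:
  "(SOME c. c \<in> A \<and> x \<in> fst c) \<in> A" "x \<in> fst (SOME c. c \<in> A \<and> x \<in> fst c)"
  using someI_ex[of "\<lambda>c. c \<in> A \<and> x \<in> fst c"] chart_at[of x] by blast+

lemma dirder_const: "dirder A (\<lambda>y. a) x v = 0"
  by (simp add: dirder_def comp_def frechet_derivative_const)

lemma dirder_lin:
  assumes W: "open W" "x \<in> W" and f: "smooth_fun_on A W f" and g: "smooth_fun_on A W g"
  shows "dirder A (\<lambda>y. a *\<^sub>R f y + b *\<^sub>R g y) x v = a *\<^sub>R dirder A f x v + b *\<^sub>R dirder A g x v"
proof -
  define c where "c = (SOME c. c \<in> A \<and> x \<in> fst c)"
  have c: "c \<in> A" "x \<in> fst c" unfolding c_def by (rule some_chart)+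
  have D: "((f \<circ> chart_inv c) has_derivative frechet_derivative (f \<circ> chart_inv c) (at (snd c x))) (at (snd c x))"
    "((g \<circ> chart_inv c) has_derivative frechet_derivative (g \<circ> chart_inv c) (at (snd c x))) (at (snd c x))"
    using smooth_fun_on_differentiable[OF f W c(1,2)] smooth_fun_on_differentiable[OF g W c(1,2)]
    by (simp_all add: frechet_derivative_works[symmetric])
  have "(\<lambda>y. a *\<^sub>R f y + b *\<^sub>R g y) \<circ> chart_inv c =
      (\<lambda>z. a *\<^sub>R (f \<circ> chart_inv c) z + b *\<^sub>R (g \<circ> chart_inv c) z)" by auto
  then have "frechet_derivative ((\<lambda>y. a *\<^sub>R f y + b *\<^sub>R g y) \<circ> chart_inv c) (at (snd c x)) =
      (\<lambda>v. a *\<^sub>R frechet_derivative (f \<circ> chart_inv c) (at (snd c x)) v +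
        b *\<^sub>R frechet_derivative (g \<circ> chart_inv c) (at (snd c x)) v)"
    using frechet_derivative_at[OF has_derivative_add[OF has_derivative_scaleR_right[OF D(1)]
      has_derivative_scaleR_right[OF D(2)]]] by metis
  then show ?thesis by (simp add: dirder_def Let_def c_def[symmetric])
qed

lemma dirder_scaleR:
  assumes W: "open W" "x \<in> W" and f: "smooth_fun_on A W f" and g: "smooth_fun_on A W g"
  shows "dirder A (\<lambda>y. f y *\<^sub>R g y) x v = f x *\<^sub>R dirder A g x v + dirder A f x v *\<^sub>R g x"
proof -
  define c where "c = (SOME c. c \<in> A \<and> x \<in> fst c)"
  have c: "c \<in> A" "x \<in> fst c" unfolding c_def by (rule some_chart)+
  have D: "((f \<circ> chart_inv c) has_derivative frechet_derivative (f \<circ> chart_inv c) (at (snd c x))) (at (snd c x))"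
    "((g \<circ> chart_inv c) has_derivative frechet_derivative (g \<circ> chart_inv c) (at (snd c x))) (at (snd c x))"
    using smooth_fun_on_differentiable[OF f W c] smooth_fun_on_differentiable[OF g W c]
    by (simp_all add: frechet_derivative_works[symmetric])
  have "(\<lambda>y. f y *\<^sub>R g y) \<circ> chart_inv c =
      (\<lambda>z. (f \<circ> chart_inv c) z *\<^sub>R (g \<circ> chart_inv c) z)" by auto
  then have "frechet_derivative ((\<lambda>y. f y *\<^sub>R g y) \<circ> chart_inv c) (at (snd c x)) =
      (\<lambda>v. (f \<circ> chart_inv c) (snd c x) *\<^sub>R frechet_derivative (g \<circ> chart_inv c) (at (snd c x)) v +
        frechet_derivative (f \<circ> chart_inv c) (at (snd c x)) v *\<^sub>R (g \<circ> chart_inv c) (snd c x))"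
    using frechet_derivative_at[OF has_derivative_scaleR[OF D]] by metis
  then show ?thesis unfolding dirder_def c_def[symmetric] Let_def using c by simp
qed

text \<open>The extension of a tangent vector to a field with constant coordinates in the chart \<open>c\<close>.\<close>

definition const_field :: "('m, 'e) chart \<Rightarrow> ('m, 'e) tvec \<Rightarrow> 'm \<Rightarrow> ('m, 'e) tvec" where
  "const_field c v y = (\<lambda>c'. if c' \<in> A \<and> y \<in> fst c'
     then frechet_derivative (snd c' \<circ> chart_inv c) (at (snd c y)) (v c) else 0)"

lemma const_field_at:
  assumes "c \<in> A" "x \<in> fst c" "v \<in> tspace A x"
  shows "const_field c v x = v"
proof
  show "const_field c v x c' = v c'" for c'
    using tspace_transition[OF assms(3,1) _ assms(2)] tspace_outside[OF assms(3)]
    by (auto simp: const_field_def)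
qed

text \<open>Tangency is the cocycle rule. For smoothness, the coordinates in \<open>c1\<close> as
  seen in the chart \<open>c2\<close> are the derivative of the change from \<open>c\<close> to
  \<open>c1\<close>, in a fixed direction, composed with the change from \<open>c2\<close> to
  \<open>c\<close>; this composition calls for the chain rule of every order.\<close>

lemma vfield_const_field:
  assumes c: "c \<in> A"
  shows "vfield_on A (fst c) (const_field c v)"
  unfolding vfield_on_def smooth_fun_on_def
proof (intro conjI ballI)
  fix x assume "x \<in> fst c"
  then have "const_field c v x c2 =
      frechet_derivative (snd c2 \<circ> chart_inv c1) (at (snd c1 x)) (const_field c v x c1)"
    if "c1 \<in> A" "c2 \<in> A" "x \<in> fst c1 \<inter> fst c2" for c1 c2
    using transition_chain[OF c that(1,2)] that by (simp add: const_field_def)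
  moreover have "const_field c v x c' = 0" if "\<not> (c' \<in> A \<and> x \<in> fst c')" for c'
    using that by (auto simp: const_field_def)
  ultimately show "const_field c v x \<in> tspace A x"
    unfolding tspace_def by blast
next
  obtain E :: "'e set" where E: "finite E" "span E = UNIV" by (rule finite_dim)
  fix c1 c2 assume A: "c1 \<in> A" "c2 \<in> A"
  define S where "S = snd c2 ` (fst c2 \<inter> (fst c \<inter> fst c1))"
  define T where "T = snd c ` (fst c \<inter> fst c1)"
  have S: "open S" unfolding S_def using A c by (intro chart_image_open open_Int chart_open)
  have T: "open T" unfolding T_def using A c by (intro chart_image_open chart_open)
  have "smooth_on S ((\<lambda>z. frechet_derivative (snd c1 \<circ> chart_inv c) (at z) (v c)) \<circ> (snd c \<circ> chart_inv c2))"
  proof (rule smooth_on_compose[OF E S T])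
    show "smooth_on S (snd c \<circ> chart_inv c2)"
      by (rule smooth_on_subset[OF transition_smooth[OF A(2) c]]) (auto simp: S_def)
    show "smooth_on T (\<lambda>z. frechet_derivative (snd c1 \<circ> chart_inv c) (at z) (v c))"
      unfolding T_def by (intro smooth_on_frechet_derivative transition_smooth c A)
    show "(snd c \<circ> chart_inv c2) ` S \<subseteq> T" using A by (auto simp: S_def T_def)
  qed
  then show "smooth_on (snd c2 ` (fst c2 \<inter> (fst c \<inter> fst c1))) ((\<lambda>x. const_field c v x c1) \<circ> chart_inv c2)"
    unfolding S_def[symmetric]
    by (rule smooth_on_cong[OF S, rotated]) (use A in \<open>auto simp: S_def const_field_def\<close>)
qed

lemma differential_dual:
  assumes f: "smooth_fun_on A UNIV f"
  shows "differential A f x \<in> dual (tspace A x)"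
proof -
  define c where "c = (SOME c. c \<in> A \<and> x \<in> fst c)"
  have c: "c \<in> A" "x \<in> fst c" unfolding c_def by (rule some_chart)+
  have lin: "linear (frechet_derivative (f \<circ> chart_inv c) (at (snd c x)))"
    using smooth_fun_on_differentiable[OF f _ _ c(1,2)] by (intro linear_frechet_derivative) auto
  have "a *\<^sub>R u + b *\<^sub>R v \<in> tspace A x" if "u \<in> tspace A x" "v \<in> tspace A x" for a b u v
    using that subspace_add[OF subspace_tspace] subspace_scale[OF subspace_tspace] by blast
  then show ?thesis
    by (auto simp: dual_def lin_on_def differential_def dirder_def Let_def c_def[symmetric] linear_add[OF lin] linear_scale[OF lin])
qed

text \<open>Assumes differentiability in charts rather than smoothness of \<open>f\<close>, because
  it is applied to conjugation by a group element, for which exactly this is derived.\<close>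

lemma tmap_lin:
  assumes "\<And>c d. c \<in> A \<Longrightarrow> x \<in> fst c \<Longrightarrow> d \<in> A' \<Longrightarrow> f x \<in> fst d \<Longrightarrow>
      (snd d \<circ> f \<circ> chart_inv c) differentiable at (snd c x)"
  shows "tmap A A' f x (a *\<^sub>R u + b *\<^sub>R v) = a *\<^sub>R tmap A A' f x u + b *\<^sub>R tmap A A' f x v"
proof
  fix d
  show "tmap A A' f x (a *\<^sub>R u + b *\<^sub>R v) d = (a *\<^sub>R tmap A A' f x u + b *\<^sub>R tmap A A' f x v) d"
  proof (cases "d \<in> A' \<and> f x \<in> fst d")
    case True
    define c where "c = (SOME c. c \<in> A \<and> x \<in> fst c)"
    have c: "c \<in> A" "x \<in> fst c" unfolding c_def by (rule some_chart)+
    have lin: "linear (frechet_derivative (snd d \<circ> f \<circ> chart_inv c) (at (snd c x)))"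
      using assms[of c d] True c by (intro linear_frechet_derivative) auto
    show ?thesis using True
      by (simp add: tmap_def dirder_def Let_def c_def[symmetric] linear_add[OF lin] linear_scale[OF lin])
  qed (auto simp: tmap_def)
qed

end

section \<open>Smooth maps between manifolds\<close>

lemma smooth_map_on_chart:
  assumes "smooth_map_on T A UNIV f" "c \<in> T" "d \<in> A"
  shows "smooth_on (snd c ` (fst c \<inter> f -` fst d)) (snd d \<circ> f \<circ> chart_inv c)"
proof -
  have "fst c \<inter> f -` fst d = {x \<in> fst c \<inter> UNIV. f x \<in> fst d}" by auto
  moreover have "smooth_on (snd c ` {x \<in> fst c \<inter> UNIV. f x \<in> fst d}) (snd d \<circ> f \<circ> chart_inv c)"
    using assms unfolding smooth_map_on_def by blast
  ultimately show ?thesis by simp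
qed

lemma smooth_map_continuous: "smooth_map_on T A UNIV f \<Longrightarrow> continuous_on UNIV f"
  by (simp add: smooth_map_on_def)

locale manifold_map = A: manifold A + T: manifold T
  for A :: "('m::{t2_space, second_countable_topology}, 'e::real_normed_vector) chart set"
    and T :: "('p::{t2_space, second_countable_topology}, 'r::real_normed_vector) chart set" +
  fixes f :: "'p \<Rightarrow> 'm"
  assumes smooth_map: "smooth_map_on T A UNIV f"
begin

lemma open_vimage_map: "open W \<Longrightarrow> open (f -` W)"
  using smooth_map_continuous[OF smooth_map] by (simp add: continuous_on_open_vimage)

lemma map_differentiable:
  assumes "c \<in> T" "x \<in> fst c" "d \<in> A" "f x \<in> fst d"
  shows "(snd d \<circ> f \<circ> chart_inv c) differentiable at (snd c x)"
  using assms
  by (intro smooth_on_differentiable[OF smooth_map_on_chart[OF smooth_map]]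
      T.chart_image_open open_vimage_map A.chart_open) auto

text \<open>Near a point whose image lies in a chart \<open>d\<close>, the coordinate expression
  factors through \<open>d\<close>. One \<open>d\<close> may not serve for all of \<open>c\<close>,
  hence the passage to a neighbourhood.\<close>

lemma smooth_fun_on_pullback:
  assumes W: "open W" and F: "smooth_fun_on A W F"
  shows "smooth_fun_on T (f -` W) (\<lambda>p. F (f p))"
  unfolding smooth_fun_on_def
proof
  obtain E :: "'e set" where E: "finite E" "span E = UNIV" by (rule A.finite_dim)
  fix c assume c: "c \<in> T"
  show "smooth_on (snd c ` (fst c \<inter> f -` W)) ((\<lambda>p. F (f p)) \<circ> chart_inv c)"
  proof (rule smooth_on_local)
    fix z assume "z \<in> snd c ` (fst c \<inter> f -` W)"
    then obtain p where p: "z = snd c p" "p \<in> fst c" "f p \<in> W" by auto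
    obtain d where d: "d \<in> A" "f p \<in> fst d" by (rule A.chart_at)
    define S where "S = snd c ` (fst c \<inter> f -` (fst d \<inter> W))"
    have S: "open S"
      unfolding S_def using c d W by (intro T.chart_image_open open_vimage_map open_Int A.chart_open)
    have R: "open (snd d ` (fst d \<inter> W))" using d W by (intro A.chart_image_open)
    have "smooth_on S ((F \<circ> chart_inv d) \<circ> (snd d \<circ> f \<circ> chart_inv c))"
    proof (rule smooth_on_compose[OF E S R])
      show "smooth_on S (snd d \<circ> f \<circ> chart_inv c)"
        by (rule smooth_on_subset[OF smooth_map_on_chart[OF smooth_map c d(1)]]) (auto simp: S_def)
      show "smooth_on (snd d ` (fst d \<inter> W)) (F \<circ> chart_inv d)"
        using F d(1) by (simp add: smooth_fun_on_def)
      show "(snd d \<circ> f \<circ> chart_inv c) ` S \<subseteq> snd d ` (fst d \<inter> W)" using c by (auto simp: S_def)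
    qed
    then have "smooth_on S ((\<lambda>p. F (f p)) \<circ> chart_inv c)"
      by (rule smooth_on_cong[OF S, rotated]) (use c d in \<open>auto simp: S_def\<close>)
    moreover have "z \<in> S" using p d by (auto simp: S_def)
    ultimately show "\<exists>S. open S \<and> z \<in> S \<and> smooth_on S ((\<lambda>p. F (f p)) \<circ> chart_inv c)"
      using S by blast
  qed
qed

text \<open>Chain rule between two unrelated picks of \<open>SOME\<close>, a chart at
  \<open>p\<close> and one at \<open>f p\<close>. The entry of \<open>tmap\<close> at the second
  chart is computed in the first one, so the two fit together.\<close>

lemma dirder_pullback:
  assumes W: "open W" "f p \<in> W" and F: "smooth_fun_on A W F"
  shows "dirder T (\<lambda>q. F (f q)) p w = dirder A F (f p) (tmap T A f p w)"
proof -
  define c where "c = (SOME c. c \<in> T \<and> p \<in> fst c)"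
  define d where "d = (SOME d. d \<in> A \<and> f p \<in> fst d)"
  have c: "c \<in> T" "p \<in> fst c"
    unfolding c_def by (rule T.some_chart)+
  have d: "d \<in> A" "f p \<in> fst d"
    unfolding d_def by (rule A.some_chart)+
  have "open (snd c ` (fst c \<inter> f -` fst d))"
    using c d by (intro T.chart_image_open open_vimage_map A.chart_open)
  then have "frechet_derivative ((\<lambda>q. F (f q)) \<circ> chart_inv c) (at (snd c p)) v =
     frechet_derivative (F \<circ> chart_inv d) (at (snd d (f p)))
       (frechet_derivative (snd d \<circ> f \<circ> chart_inv c) (at (snd c p)) v)" for v
    using c d
    by (intro frechet_derivative_compose_local(2)[where S = "snd c ` (fst c \<inter> f -` fst d)"]
        map_differentiable A.smooth_fun_on_differentiable[OF F W]) auto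
  then show ?thesis
    using d by (simp add: dirder_def tmap_def Let_def c_def[symmetric] d_def[symmetric])
qed

end

section \<open>The adjoint bundle and forms with values in it\<close>

lemma sum_fun_apply: "(\<Sum>i\<in>I. f i) x = (\<Sum>i\<in>I. f i x)"
  by (induction I rule: infinite_finite_induct) auto

locale gauge_theory =
  fixes B :: "('m::{t2_space, second_countable_topology}, 'e::real_normed_vector,
      'g::{t2_space, second_countable_topology}, 'k::real_normed_vector,
      'p::{t2_space, second_countable_topology}, 'r::real_normed_vector) gauge_bundle"
  assumes principal: "principal_bundle B" and conn: "connection B"
begin

sublocale M: manifold "base B"
  using principal by unfold_locales (simp add: principal_bundle_def)

sublocale G: manifold "grp B"
  using principal by unfold_locales (simp add: principal_bundle_def lie_group_def)

sublocale P: manifold_map "base B" "tot B" "proj B"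
  using principal by unfold_locales (simp_all add: principal_bundle_def)

sublocale group "mul B" "unit B" "ginv B"
  using principal by (simp add: principal_bundle_def lie_group_def)

lemma trivialization:
  obtains U \<Psi> where "x \<in> U" "\<Psi> ` (U \<times> UNIV) = proj B -` U"
    "\<And>y g. y \<in> U \<Longrightarrow> proj B (\<Psi> (y, g)) = y"
    "\<And>y g h. y \<in> U \<Longrightarrow> act B (\<Psi> (y, g)) h = \<Psi> (y, mul B g h)"
proof -
  obtain U \<Psi> where "x \<in> U" "bij_betw \<Psi> (U \<times> UNIV) (proj B -` U)"
    "\<forall>y\<in>U. \<forall>g h. proj B (\<Psi> (y, g)) = y \<and> act B (\<Psi> (y, g)) h = \<Psi> (y, mul B g h)"
    using principal unfolding principal_bundle_def by metis
  then show ?thesis using that[of U \<Psi>] by (simp add: bij_betw_def)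
qed

lemma proj_surj: obtains p where "proj B p = x"
  using trivialization[of x] by metis

text \<open>In one trivialization the points are \<open>\<Psi> (x, g)\<close> and
  \<open>\<Psi> (x, h)\<close>, and multiplying by the inverse of \<open>g\<close> times
  \<open>h\<close> carries the first to the second.\<close>

lemma fibre_transitive:
  assumes "proj B p = proj B q"
  obtains g where "q = act B p g"
proof -
  obtain U \<Psi> where U: "proj B p \<in> U" "\<Psi> ` (U \<times> UNIV) = proj B -` U"
    "\<And>y g. y \<in> U \<Longrightarrow> proj B (\<Psi> (y, g)) = y"
    "\<And>y g h. y \<in> U \<Longrightarrow> act B (\<Psi> (y, g)) h = \<Psi> (y, mul B g h)"
    using trivialization[of "proj B p"] by blast
  have ex: "\<exists>g. r = \<Psi> (proj B r, g)" if "proj B r \<in> U" for r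
  proof -
    have "r \<in> \<Psi> ` (U \<times> UNIV)" using that U(2) by simp
    then obtain y g where yg: "y \<in> U" "r = \<Psi> (y, g)" by auto
    then show ?thesis using U(3)[OF yg(1)] by metis
  qed
  obtain g h where "p = \<Psi> (proj B p, g)" "q = \<Psi> (proj B p, h)"
    using ex[of p] ex[of q] U(1) assms by metis
  moreover have "mul B g (mul B (ginv B g) h) = h"
    by (metis assoc left_neutral right_inverse)
  ultimately show ?thesis using that[of "mul B (ginv B g) h"] U(1,4) by metis
qed

section \<open>Group translations and the adjoint action\<close>

lemma mul_continuous: "continuous_on UNIV (mul B g)" "continuous_on UNIV (\<lambda>h. mul B h g)"
proof -
  have "continuous_on UNIV (\<lambda>(x, y). mul B x y)"
    using principal by (simp add: principal_bundle_def lie_group_def smooth_map_on_def)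
  then have c: "continuous_on UNIV (\<lambda>z. mul B (fst z) (snd z))" by (simp add: case_prod_beta)
  show "continuous_on UNIV (mul B g)"
    using continuous_on_compose2[OF c, of UNIV "\<lambda>h. (g, h)"] by (simp add: continuous_on_Pair)
  show "continuous_on UNIV (\<lambda>h. mul B h g)"
    using continuous_on_compose2[OF c, of UNIV "\<lambda>h. (h, g)"] by (simp add: continuous_on_Pair)
qed

text \<open>Smoothness of multiplication in the product atlas, unfolded to a pair of charts. It is
  kept as differentiability within the coordinate domain, since it is only restricted to slices
  afterwards.\<close>

lemma mul_chart_differentiable:
  assumes "c1 \<in> grp B" "c2 \<in> grp B" "d \<in> grp B" "g \<in> fst c1" "h \<in> fst c2" "mul B g h \<in> fst d"
  shows "(\<lambda>z. snd d (mul B (chart_inv c1 (fst z)) (chart_inv c2 (snd z)))) differentiable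
    at (snd c1 g, snd c2 h) within
      {(snd c1 g', snd c2 h') | g' h'. g' \<in> fst c1 \<and> h' \<in> fst c2 \<and> mul B g' h' \<in> fst d}"
proof -
  define k where "k = (fst c1 \<times> fst c2, map_prod (snd c1) (snd c2))"
  have k: "k \<in> prod_atlas (grp B) (grp B)" using assms(1,2) by (auto simp: prod_atlas_def k_def)
  define Z where "Z = {z \<in> fst k \<inter> UNIV. (\<lambda>(x, y). mul B x y) z \<in> fst d}"
  have "smooth_on (snd k ` Z) (snd d \<circ> (\<lambda>(x, y). mul B x y) \<circ> chart_inv k)"
    using principal k assms(3)
    unfolding principal_bundle_def lie_group_def smooth_map_on_def Z_def by blast
  then have "(snd d \<circ> (\<lambda>(x, y). mul B x y) \<circ> chart_inv k) differentiable_on snd k ` Z"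
    unfolding smooth_on_def by (metis Ck_on.simps(2))
  moreover have "snd k ` Z = {(snd c1 g', snd c2 h') | g' h'. g' \<in> fst c1 \<and> h' \<in> fst c2 \<and> mul B g' h' \<in> fst d}"
    by (force simp: Z_def k_def)
  moreover have "(snd d \<circ> (\<lambda>(x, y). mul B x y) \<circ> chart_inv k) z =
      snd d (mul B (chart_inv c1 (fst z)) (chart_inv c2 (snd z)))" if "z \<in> snd k ` Z" for z
  proof -
    \<comment> \<open>\<open>chart_inv\<close> is an \<open>inv_into\<close>, so injectivity already
      shows that the inverse of a product chart is the pair of inverses.\<close>
    have "inj_on (snd k) (fst k)"
      using assms(1,2)[THEN G.chart_inv_chart] by (auto simp: k_def inj_on_def) (metis)+
    then have "chart_inv k (snd k (x, y)) = (x, y)" if "(x, y) \<in> fst k" for x y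
      unfolding chart_inv_def using that by (rule inv_into_f_f)
    then show ?thesis using that assms(1,2) by (auto simp: Z_def k_def)
  qed
  ultimately have "(\<lambda>z. snd d (mul B (chart_inv c1 (fst z)) (chart_inv c2 (snd z)))) differentiable_on
      {(snd c1 g', snd c2 h') | g' h'. g' \<in> fst c1 \<and> h' \<in> fst c2 \<and> mul B g' h' \<in> fst d}"
    unfolding differentiable_on_def differentiable_def by (metis (no_types, lifting) has_derivative_transform)
  then show ?thesis using assms(4-6) unfolding differentiable_on_def by blast
qed

text \<open>Multiplication is restricted to the slice on which the first coordinate is that of
  \<open>g\<close>. The slice domain \<open>Y\<close> is open, which turns differentiability within
  \<open>Y\<close> into differentiability at the point.\<close>

lemma left_mul_differentiable:
  assumes c: "c \<in> grp B" "x \<in> fst c" and d: "d \<in> grp B" "mul B g x \<in> fst d"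
  shows "(snd d \<circ> mul B g \<circ> chart_inv c) differentiable at (snd c x)"
proof -
  obtain c1 where c1: "c1 \<in> grp B" "g \<in> fst c1" by (rule G.chart_at)
  define Y where "Y = snd c ` (fst c \<inter> mul B g -` fst d)"
  have "open (mul B g -` fst d)"
    using mul_continuous(1) G.chart_open[OF d(1)] by (simp add: continuous_on_open_vimage)
  then have Y: "open Y" unfolding Y_def by (rule G.chart_image_open[OF c(1)])
  have mem: "snd c x \<in> Y" using c d by (auto simp: Y_def)
  have sub: "(\<lambda>z. (snd c1 g, z)) ` Y \<subseteq>
      {(snd c1 g', snd c h') | g' h'. g' \<in> fst c1 \<and> h' \<in> fst c \<and> mul B g' h' \<in> fst d}"
    using c1 by (auto simp: Y_def)
  have 1: "(\<lambda>z. (snd c1 g, z)) differentiable at (snd c x) within Y"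
    by (intro differentiableI[where f' = "\<lambda>z. (0, z)"]) (auto intro!: derivative_eq_intros)
  have "((\<lambda>z. snd d (mul B (chart_inv c1 (fst z)) (chart_inv c (snd z)))) \<circ> (\<lambda>z. (snd c1 g, z)))
      differentiable at (snd c x) within Y"
    by (rule differentiable_chain_within[OF 1 differentiable_subset[OF
          mul_chart_differentiable[OF c1(1) c(1) d(1) c1(2) c(2) d(2)] sub]])
  moreover have "((\<lambda>z. snd d (mul B (chart_inv c1 (fst z)) (chart_inv c (snd z)))) \<circ> (\<lambda>z. (snd c1 g, z)))
      = (snd d \<circ> mul B g \<circ> chart_inv c)"
    using c1 by (simp add: fun_eq_iff)
  ultimately show ?thesis using at_within_open[OF mem Y] by simp
qed

lemma right_mul_differentiable:
  assumes c: "c \<in> grp B" "x \<in> fst c" and d: "d \<in> grp B" "mul B x g \<in> fst d"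
  shows "(snd d \<circ> (\<lambda>x. mul B x g) \<circ> chart_inv c) differentiable at (snd c x)"
proof -
  obtain c1 where c1: "c1 \<in> grp B" "g \<in> fst c1" by (rule G.chart_at)
  define Y where "Y = snd c ` (fst c \<inter> (\<lambda>x. mul B x g) -` fst d)"
  have "open ((\<lambda>x. mul B x g) -` fst d)"
    using mul_continuous(2) G.chart_open[OF d(1)] by (simp add: continuous_on_open_vimage)
  then have Y: "open Y" unfolding Y_def by (rule G.chart_image_open[OF c(1)])
  have mem: "snd c x \<in> Y" using c d by (auto simp: Y_def)
  have sub: "(\<lambda>z. (z, snd c1 g)) ` Y \<subseteq>
      {(snd c g', snd c1 h') | g' h'. g' \<in> fst c \<and> h' \<in> fst c1 \<and> mul B g' h' \<in> fst d}"
    using c1 by (auto simp: Y_def)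
  have 1: "(\<lambda>z. (z, snd c1 g)) differentiable at (snd c x) within Y"
    by (intro differentiableI[where f' = "\<lambda>z. (z, 0)"]) (auto intro!: derivative_eq_intros)
  have "((\<lambda>z. snd d (mul B (chart_inv c (fst z)) (chart_inv c1 (snd z)))) \<circ> (\<lambda>z. (z, snd c1 g)))
      differentiable at (snd c x) within Y"
    by (rule differentiable_chain_within[OF 1 differentiable_subset[OF
          mul_chart_differentiable[OF c(1) c1(1) d(1) c(2) c1(2) d(2)] sub]])
  moreover have "((\<lambda>z. snd d (mul B (chart_inv c (fst z)) (chart_inv c1 (snd z)))) \<circ> (\<lambda>z. (z, snd c1 g)))
      = (snd d \<circ> (\<lambda>x. mul B x g) \<circ> chart_inv c)"
    using c1 by (simp add: fun_eq_iff)
  ultimately show ?thesis using at_within_open[OF mem Y] by simp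
qed

text \<open>Conjugation is a left translation followed by a right translation, with a chart
  \<open>c1\<close> around the intermediate point. Linearity of \<open>Ad\<close> is what makes the
  equivariant maps on a fibre a vector space.\<close>

lemma Ad_lin: "Ad B g (a *\<^sub>R u + b *\<^sub>R v) = a *\<^sub>R Ad B g u + b *\<^sub>R Ad B g v"
  unfolding Ad_def
proof (rule G.tmap_lin)
  fix c d
  assume c: "c \<in> grp B" "unit B \<in> fst c" and d: "d \<in> grp B" "mul B (mul B g (unit B)) (ginv B g) \<in> fst d"
  obtain c1 where c1: "c1 \<in> grp B" "mul B g (unit B) \<in> fst c1" by (rule G.chart_at)
  have "open (mul B g -` fst c1)"
    using mul_continuous(1) G.chart_open[OF c1(1)] by (simp add: continuous_on_open_vimage)
  then have "open (snd c ` (fst c \<inter> mul B g -` fst c1))" by (rule G.chart_image_open[OF c(1)])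
  then show "(snd d \<circ> (\<lambda>h. mul B (mul B g h) (ginv B g)) \<circ> chart_inv c) differentiable at (snd c (unit B))"
    using c c1
    by (intro frechet_derivative_compose_local(1)[OF left_mul_differentiable[OF c c1] _
          right_mul_differentiable[OF c1 d], where S = "snd c ` (fst c \<inter> mul B g -` fst c1)"]) auto
qed

section \<open>Fibres of the adjoint bundle and their duals\<close>

lemma subspace_ad_fibre: "subspace (ad_fibre B x)"
proof (rule subspaceI)
  have Ad0: "Ad B g 0 = 0" for g using Ad_lin[of g 0 0 0 0] by simp
  note L = G.subspace_tspace[of "unit B"]
  show "0 \<in> ad_fibre B x"
    using subspace_0[OF L] by (simp add: ad_fibre_def liealg_def Ad0)
  show "h + h' \<in> ad_fibre B x" if "h \<in> ad_fibre B x" "h' \<in> ad_fibre B x" for h h'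
    using that subspace_add[OF L] Ad_lin[of _ 1 _ 1] by (simp add: ad_fibre_def liealg_def)
  show "a *\<^sub>R h \<in> ad_fibre B x" if "h \<in> ad_fibre B x" for h a
    using that subspace_scale[OF L] Ad_lin[of _ a _ 0] by (simp add: ad_fibre_def liealg_def)
qed

text \<open>Equivariance propagates the value at \<open>p\<close> along the whole fibre, on which
  the group acts transitively.\<close>

lemma inj_on_ad_fibre: "inj_on (\<lambda>h. h p) (ad_fibre B (proj B p))"
proof (rule inj_onI)
  fix h h' assume h: "h \<in> ad_fibre B (proj B p)" "h' \<in> ad_fibre B (proj B p)" "h p = h' p"
  show "h = h'"
  proof
    show "h q = h' q" for q
    proof (cases "proj B q = proj B p")
      case True
      then obtain g where "q = act B p g" using fibre_transitive by metis
      then show ?thesis using h by (simp add: ad_fibre_def)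
    qed (use h in \<open>simp add: ad_fibre_def\<close>)
  qed
qed

text \<open>The formula for \<open>d\<close> evaluates at elements
  \<open>coad_class B p \<psi>\<close> only; this shows that nothing on the dual of the fibre
  escapes it.\<close>

lemma coad_class_surj:
  assumes "\<phi> \<in> dual (ad_fibre B (proj B p))"
  obtains \<psi> where "\<psi> \<in> dual (liealg B)" "coad_class B p \<psi> = \<phi>"
proof -
  let ?V = "ad_fibre B (proj B p)"
  have "linear (\<lambda>h. h p)" for p :: 'p by (rule linearI) simp_all
  \<comment> \<open>A left inverse of evaluation at \<open>p\<close> that is linear on the whole
    space with values in the fibre, so that composing \<phi> with it is linear on all of the Lie
    algebra.\<close>
  then obtain g where g: "range g \<subseteq> ?V" "linear g" "\<And>h. h \<in> ?V \<Longrightarrow> g (h p) = h"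
    using linear_exists_left_inverse_on[OF _ subspace_ad_fibre inj_on_ad_fibre] by metis
  define \<psi> where "\<psi> v = (if v \<in> liealg B then \<phi> (g v) else 0)" for v
  have "subspace (liealg B)" using G.subspace_tspace by (simp add: liealg_def)
  then have "a *\<^sub>R u + b *\<^sub>R v \<in> liealg B" if "u \<in> liealg B" "v \<in> liealg B" for a b u v
    using that subspace_add subspace_scale by blast
  moreover have "\<phi> (a *\<^sub>R g u + b *\<^sub>R g v) = a * \<phi> (g u) + b * \<phi> (g v)" for a b u v
    using assms g(1) unfolding dual_def lin_on_def by (auto simp: image_subset_iff)
  ultimately have "\<psi> \<in> dual (liealg B)"
    by (auto simp: dual_def lin_on_def \<psi>_def linear_add[OF g(2)] linear_scale[OF g(2)])
  moreover have "coad_class B p \<psi> h = \<phi> h" for h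
    using assms g(3) by (auto simp: coad_class_def \<psi>_def dual_def ad_fibre_def)
  ultimately show ?thesis using that by blast
qed

section \<open>Horizontal lifts and equality of forms\<close>

lemma tmap_hlift:
  assumes "v \<in> tspace (base B) (proj B p)"
  shows "tmap (tot B) (base B) (proj B) p (hlift B p v) = v"
proof -
  have "bij_betw (tmap (tot B) (base B) (proj B) p) (hor B p) (tspace (base B) (proj B p))"
    using conn by (simp add: connection_def)
  then have inj: "inj_on (tmap (tot B) (base B) (proj B) p) (hor B p)"
    and surj: "v \<in> tmap (tot B) (base B) (proj B) p ` hor B p"
    using assms by (simp_all add: bij_betw_def)
  from surj obtain w where "w \<in> hor B p" "tmap (tot B) (base B) (proj B) p w = v" by blast
  then have "\<exists>!w. w \<in> hor B p \<and> tmap (tot B) (base B) (proj B) p w = v"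
    using inj_onD[OF inj] by blast
  then show ?thesis unfolding hlift_def by (rule theI'[THEN conjunct2])
qed

lemma dirder_proj_hlift:
  assumes "smooth_fun_on (base B) UNIV f" "v \<in> tspace (base B) (proj B p)"
  shows "dirder (tot B) (\<lambda>q. f (proj B q)) p (hlift B p v) = differential (base B) f (proj B p) v"
  using P.dirder_pullback[OF open_UNIV UNIV_I assms(1)] assms(2)
  by (simp add: tmap_hlift differential_def)

text \<open>The test data in the formula for \<open>d\<close> separate forms: tangent vectors extend
  over a chart domain by \<open>const_field\<close>, functionals on the fibre are reached by
  \<open>coad_class_surj\<close>, and at all other arguments both sides are 0.\<close>

lemma form_eqI:
  assumes "\<eta> \<in> alt_forms p (tspace (base B) x) (sym_pow q (ad_fibre B x))"
    and "\<theta> \<in> alt_forms p (tspace (base B) x) (sym_pow q (ad_fibre B x))"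
    and "\<And>U Xs r \<psi>. open U \<Longrightarrow> length Xs = p \<Longrightarrow> \<forall>X\<in>set Xs. vfield_on (base B) U X \<Longrightarrow> x \<in> U \<Longrightarrow>
      proj B r = x \<Longrightarrow> \<psi> \<in> dual (liealg B) \<Longrightarrow>
      \<eta> (map (\<lambda>X. X x) Xs) (coad_class B r \<psi>) = \<theta> (map (\<lambda>X. X x) Xs) (coad_class B r \<psi>)"
  shows "\<eta> = \<theta>"
proof (rule alt_forms_eqI[OF assms(1,2)])
  fix vs assume vs: "length vs = p" "set vs \<subseteq> tspace (base B) x"
  obtain c where c: "c \<in> base B" "x \<in> fst c" by (rule M.chart_at)
  obtain r where r: "proj B r = x" by (rule proj_surj)
  define Xs where "Xs = map (M.const_field c) vs"
  have at: "map (\<lambda>X. X x) Xs = vs"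
    using vs(2) M.const_field_at[OF c] by (auto simp: Xs_def intro!: map_idI)
  have Xs: "length Xs = p" "\<forall>X\<in>set Xs. vfield_on (base B) (fst c) X"
    using vs M.vfield_const_field[OF c(1)] by (auto simp: Xs_def)
  show "\<eta> vs = \<theta> vs"
  proof
    fix \<phi>
    show "\<eta> vs \<phi> = \<theta> vs \<phi>"
    proof (cases "\<phi> \<in> dual (ad_fibre B x)")
      case True
      then obtain \<psi> where \<psi>: "\<psi> \<in> dual (liealg B)" "coad_class B r \<psi> = \<phi>"
        using coad_class_surj[of \<phi> r] r by blast
      show ?thesis
        using assms(3)[OF M.chart_open[OF c(1)] Xs c(2) r \<psi>(1)] by (simp add: at \<psi>(2))
    next
      case False
      then show ?thesis
        using sym_pow_outside alt_forms_mem[OF assms(1) vs] alt_forms_mem[OF assms(2) vs] by metis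
    qed
  qed
qed

section \<open>Bundle-valued forms as a module over smooth functions\<close>

lemma sym_forms_alt: "\<alpha> \<in> sym_forms B p q \<Longrightarrow>
    \<alpha> x \<in> alt_forms p (tspace (base B) x) (sym_pow q (ad_fibre B x))"
  by (simp add: sym_forms_def)

lemma sym_forms_smooth:
  assumes "\<alpha> \<in> sym_forms B p q" "open U" "length Xs = p" "\<forall>X\<in>set Xs. vfield_on (base B) U X"
    "\<psi> \<in> dual (liealg B)"
  shows "smooth_fun_on (tot B) (proj B -` U)
    (\<lambda>r. \<alpha> (proj B r) (map (\<lambda>X. X (proj B r)) Xs) (coad_class B r \<psi>))"
  using assms unfolding sym_forms_def by blast

lemma alt_forms_lin_comb:
  assumes "\<alpha> \<in> alt_forms p V (sym_pow q W)" "\<beta> \<in> alt_forms p V (sym_pow q W)"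
  shows "a *\<^sub>R \<alpha> + b *\<^sub>R \<beta> \<in> alt_forms p V (sym_pow q W)"
  using assms subspace_alt_forms[OF subspace_sym_pow] subspace_add subspace_scale by metis

text \<open>Smoothness of sections is measured on the total space, so the coefficient functions are
  first pulled back along the projection.\<close>

lemma sym_forms_lin_comb:
  assumes "\<alpha> \<in> sym_forms B p q" "\<beta> \<in> sym_forms B p q"
    and f: "smooth_fun_on (base B) UNIV f" and g: "smooth_fun_on (base B) UNIV g"
  shows "(\<lambda>x. f x *\<^sub>R \<alpha> x + g x *\<^sub>R \<beta> x) \<in> sym_forms B p q"
  unfolding sym_forms_def
proof (intro CollectI conjI allI impI ballI)
  show "f x *\<^sub>R \<alpha> x + g x *\<^sub>R \<beta> x \<in> alt_forms p (tspace (base B) x) (sym_pow q (ad_fibre B x))" for x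
    by (intro alt_forms_lin_comb sym_forms_alt assms)
next
  fix U Xs \<psi>
  assume "open U \<and> length Xs = p \<and> (\<forall>X\<in>set Xs. vfield_on (base B) U X)" and \<psi>: "\<psi> \<in> dual (liealg B)"
  then have U: "open U" "length Xs = p" "\<forall>X\<in>set Xs. vfield_on (base B) U X" by auto
  have pull: "smooth_fun_on (tot B) (proj B -` U) (\<lambda>r. h (proj B r))" if "smooth_fun_on (base B) UNIV h" for h :: "'m \<Rightarrow> real"
    using P.smooth_fun_on_pullback[OF U(1) M.smooth_fun_on_subset[OF that]] by simp
  note W = P.open_vimage_map[OF U(1)]
  show "smooth_fun_on (tot B) (proj B -` U)
      (\<lambda>r. (f (proj B r) *\<^sub>R \<alpha> (proj B r) + g (proj B r) *\<^sub>R \<beta> (proj B r))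
        (map (\<lambda>X. X (proj B r)) Xs) (coad_class B r \<psi>))"
    using P.T.smooth_fun_on_add[OF W
        P.T.smooth_fun_on_scaleR[OF W pull[OF f] sym_forms_smooth[OF assms(1) U \<psi>]]
        P.T.smooth_fun_on_scaleR[OF W pull[OF g] sym_forms_smooth[OF assms(2) U \<psi>]]]
    by simp
qed

lemma sym_forms_zero: "(\<lambda>x. 0) \<in> sym_forms B p q"
  unfolding sym_forms_def
  using subspace_0[OF subspace_alt_forms[OF subspace_sym_pow]]
  by (auto simp: P.T.smooth_fun_on_const)

end

section \<open>The operator and its symbol\<close>

locale gauge_complex = gauge_theory B
  for B :: "('m::{t2_space, second_countable_topology}, 'e::real_normed_vector,
      'g::{t2_space, second_countable_topology}, 'k::real_normed_vector,
      'p::{t2_space, second_countable_topology}, 'r::real_normed_vector) gauge_bundle" +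
  fixes d :: "('m \<Rightarrow> ('m, 'e, 'g, 'k, 'p) form) \<Rightarrow> 'm \<Rightarrow> ('m, 'e, 'g, 'k, 'p) form"
    and \<delta> :: "'m \<Rightarrow> ('g, 'k, 'p) sym_elt \<Rightarrow> ('g, 'k, 'p) sym_elt"
    and t :: real
  assumes d: "covariant_ext_derivative B d" and delta: "zero_order_raising B \<delta>"
begin

section \<open>Leibniz rule for the covariant exterior derivative\<close>

definition cov_terms ::
  "('m \<Rightarrow> ('m, 'e, 'g, 'k, 'p) form) \<Rightarrow> ('m \<Rightarrow> ('m, 'e) tvec) list \<Rightarrow> 'p \<Rightarrow> (('g, 'k) tvec \<Rightarrow> real) \<Rightarrow> real" where
  "cov_terms \<alpha> Xs r \<psi> = (\<Sum>i<length Xs. (-1) ^ i *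
     nabla B (\<lambda>y. \<alpha> y (map (\<lambda>X. X y) (del_nth i Xs))) r ((Xs ! i) (proj B r)) \<psi>)"

text \<open>Kept apart from \<open>cov_terms\<close>: this sum is linear over functions, whereas the
  other one produces derivatives of the coefficients.\<close>

definition bracket_terms ::
  "('m \<Rightarrow> ('m, 'e, 'g, 'k, 'p) form) \<Rightarrow> ('m \<Rightarrow> ('m, 'e) tvec) list \<Rightarrow> 'p \<Rightarrow> (('g, 'k) tvec \<Rightarrow> real) \<Rightarrow> real" where
  "bracket_terms \<alpha> Xs r \<psi> = (\<Sum>j<length Xs. \<Sum>i<j. (-1) ^ (i + j) *
     \<alpha> (proj B r)
       (lie_bracket (base B) (Xs ! i) (Xs ! j) (proj B r) #
        map (\<lambda>X. X (proj B r)) (del_nth i (del_nth j Xs)))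
       (coad_class B r \<psi>))"

lemma d_sym_forms: "\<alpha> \<in> sym_forms B p q \<Longrightarrow> d \<alpha> \<in> sym_forms B (Suc p) q"
  using d unfolding covariant_ext_derivative_def by blast

lemma d_eval:
  assumes "\<alpha> \<in> sym_forms B p q" "open U" "length Xs = Suc p" "\<forall>X\<in>set Xs. vfield_on (base B) U X"
    "proj B r \<in> U" "\<psi> \<in> dual (liealg B)"
  shows "d \<alpha> (proj B r) (map (\<lambda>X. X (proj B r)) Xs) (coad_class B r \<psi>) =
    cov_terms \<alpha> Xs r \<psi> + bracket_terms \<alpha> Xs r \<psi>"
  unfolding cov_terms_def bracket_terms_def assms(3)
  using d assms unfolding covariant_ext_derivative_def by blast

text \<open>Product rule on the total space for the equivariant functions of \<alpha> and \<beta>;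
  the pulled-back coefficients contribute their differentials on the base, by
  \<open>dirder_proj_hlift\<close>.\<close>

lemma nabla_leibniz:
  assumes \<alpha>: "\<alpha> \<in> sym_forms B p q" and \<beta>: "\<beta> \<in> sym_forms B p q"
    and f: "smooth_fun_on (base B) UNIV f" and g: "smooth_fun_on (base B) UNIV g"
    and U: "open U" "proj B r \<in> U" and Ys: "length Ys = p" "\<forall>X\<in>set Ys. vfield_on (base B) U X"
    and \<psi>: "\<psi> \<in> dual (liealg B)" and v: "v \<in> tspace (base B) (proj B r)"
  shows "nabla B (\<lambda>y. (f y *\<^sub>R \<alpha> y + g y *\<^sub>R \<beta> y) (map (\<lambda>X. X y) Ys)) r v \<psi> =
    f (proj B r) * nabla B (\<lambda>y. \<alpha> y (map (\<lambda>X. X y) Ys)) r v \<psi> +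
    g (proj B r) * nabla B (\<lambda>y. \<beta> y (map (\<lambda>X. X y) Ys)) r v \<psi> +
    (differential (base B) f (proj B r) v * \<alpha> (proj B r) (map (\<lambda>X. X (proj B r)) Ys) (coad_class B r \<psi>) +
     differential (base B) g (proj B r) v * \<beta> (proj B r) (map (\<lambda>X. X (proj B r)) Ys) (coad_class B r \<psi>))"
proof -
  note W = P.open_vimage_map[OF U(1)]
  have r: "r \<in> proj B -` U" using U(2) by simp
  have pull: "smooth_fun_on (tot B) (proj B -` U) (\<lambda>r. h (proj B r))"
    if "smooth_fun_on (base B) UNIV h" for h :: "'m \<Rightarrow> real"
    using P.smooth_fun_on_pullback[OF U(1) M.smooth_fun_on_subset[OF that]] by simp
  define a where "a r = \<alpha> (proj B r) (map (\<lambda>X. X (proj B r)) Ys) (coad_class B r \<psi>)" for r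
  define b where "b r = \<beta> (proj B r) (map (\<lambda>X. X (proj B r)) Ys) (coad_class B r \<psi>)" for r
  have a: "smooth_fun_on (tot B) (proj B -` U) a"
    using sym_forms_smooth[OF \<alpha> U(1) Ys \<psi>] by (simp add: a_def[abs_def])
  have b: "smooth_fun_on (tot B) (proj B -` U) b"
    using sym_forms_smooth[OF \<beta> U(1) Ys \<psi>] by (simp add: b_def[abs_def])
  have "dirder (tot B) (\<lambda>r. f (proj B r) *\<^sub>R a r + g (proj B r) *\<^sub>R b r) r (hlift B r v) =
      (f (proj B r) *\<^sub>R dirder (tot B) a r (hlift B r v) + differential (base B) f (proj B r) v *\<^sub>R a r) +
      (g (proj B r) *\<^sub>R dirder (tot B) b r (hlift B r v) + differential (base B) g (proj B r) v *\<^sub>R b r)"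
    using P.T.dirder_lin[OF W r P.T.smooth_fun_on_scaleR[OF W pull[OF f] a]
        P.T.smooth_fun_on_scaleR[OF W pull[OF g] b], of 1 1 "hlift B r v"]
      P.T.dirder_scaleR[OF W r pull[OF f] a] P.T.dirder_scaleR[OF W r pull[OF g] b]
      dirder_proj_hlift[OF f v] dirder_proj_hlift[OF g v]
    by simp
  then show ?thesis
    unfolding nabla_def plus_fun_apply scaleR_fun_apply a_def b_def by simp
qed

lemma wedge_eval:
  "wedge \<xi> \<eta> (map h Xs) \<phi> = (\<Sum>i<length Xs. (-1) ^ i * (\<xi> (h (Xs ! i)) * \<eta> (map h (del_nth i Xs)) \<phi>))"
  for \<eta> :: "('m, 'e, 'g, 'k, 'p) form"
  by (simp add: wedge_def sum_fun_apply map_del_nth mult.assoc)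

text \<open>The derivative terms, summed with alternating signs over the omitted field, are exactly
  the expansion \<open>wedge_eval\<close> for the two differentials.\<close>

lemma cov_terms_leibniz:
  assumes \<alpha>: "\<alpha> \<in> sym_forms B p q" and \<beta>: "\<beta> \<in> sym_forms B p q"
    and f: "smooth_fun_on (base B) UNIV f" and g: "smooth_fun_on (base B) UNIV g"
    and U: "open U" "proj B r \<in> U" and Xs: "length Xs = Suc p" "\<forall>X\<in>set Xs. vfield_on (base B) U X"
    and \<psi>: "\<psi> \<in> dual (liealg B)"
  shows "cov_terms (\<lambda>y. f y *\<^sub>R \<alpha> y + g y *\<^sub>R \<beta> y) Xs r \<psi> =
    f (proj B r) * cov_terms \<alpha> Xs r \<psi> + g (proj B r) * cov_terms \<beta> Xs r \<psi> +
    (wedge (differential (base B) f (proj B r)) (\<alpha> (proj B r)) +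
     wedge (differential (base B) g (proj B r)) (\<beta> (proj B r)))
      (map (\<lambda>X. X (proj B r)) Xs) (coad_class B r \<psi>)"
proof -
  have N: "nabla B (\<lambda>y. (f y *\<^sub>R \<alpha> y + g y *\<^sub>R \<beta> y) (map (\<lambda>X. X y) (del_nth i Xs))) r ((Xs ! i) (proj B r)) \<psi> =
      f (proj B r) * nabla B (\<lambda>y. \<alpha> y (map (\<lambda>X. X y) (del_nth i Xs))) r ((Xs ! i) (proj B r)) \<psi> +
      g (proj B r) * nabla B (\<lambda>y. \<beta> y (map (\<lambda>X. X y) (del_nth i Xs))) r ((Xs ! i) (proj B r)) \<psi> +
      (differential (base B) f (proj B r) ((Xs ! i) (proj B r)) *
        \<alpha> (proj B r) (map (\<lambda>X. X (proj B r)) (del_nth i Xs)) (coad_class B r \<psi>) +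
       differential (base B) g (proj B r) ((Xs ! i) (proj B r)) *
        \<beta> (proj B r) (map (\<lambda>X. X (proj B r)) (del_nth i Xs)) (coad_class B r \<psi>))"
    if "i < length Xs" for i
  proof (rule nabla_leibniz[OF \<alpha> \<beta> f g U _ _ \<psi>])
    show "length (del_nth i Xs) = p" using that Xs(1) by simp
    show "\<forall>X\<in>set (del_nth i Xs). vfield_on (base B) U X" using Xs(2) set_del_nth_subset[of i Xs] by auto
    show "(Xs ! i) (proj B r) \<in> tspace (base B) (proj B r)"
      using bspec[OF Xs(2) nth_mem[OF that]] U(2) by (simp add: vfield_on_def)
  qed
  have "cov_terms (\<lambda>y. f y *\<^sub>R \<alpha> y + g y *\<^sub>R \<beta> y) Xs r \<psi> = (\<Sum>i<length Xs. (-1) ^ i *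
      (f (proj B r) * nabla B (\<lambda>y. \<alpha> y (map (\<lambda>X. X y) (del_nth i Xs))) r ((Xs ! i) (proj B r)) \<psi> +
      g (proj B r) * nabla B (\<lambda>y. \<beta> y (map (\<lambda>X. X y) (del_nth i Xs))) r ((Xs ! i) (proj B r)) \<psi> +
      (differential (base B) f (proj B r) ((Xs ! i) (proj B r)) *
        \<alpha> (proj B r) (map (\<lambda>X. X (proj B r)) (del_nth i Xs)) (coad_class B r \<psi>) +
       differential (base B) g (proj B r) ((Xs ! i) (proj B r)) *
        \<beta> (proj B r) (map (\<lambda>X. X (proj B r)) (del_nth i Xs)) (coad_class B r \<psi>))))"
    unfolding cov_terms_def by (intro sum.cong[OF refl]) (simp only: lessThan_iff N)
  also have "\<dots> = f (proj B r) * cov_terms \<alpha> Xs r \<psi> + g (proj B r) * cov_terms \<beta> Xs r \<psi> +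
    (wedge (differential (base B) f (proj B r)) (\<alpha> (proj B r)) +
     wedge (differential (base B) g (proj B r)) (\<beta> (proj B r)))
      (map (\<lambda>X. X (proj B r)) Xs) (coad_class B r \<psi>)"
    unfolding plus_fun_apply wedge_eval cov_terms_def
    by (simp only: sum_distrib_left distrib_left sum.distrib mult.left_commute)
  finally show ?thesis .
qed

text \<open>The form enters only through its value at \<open>proj B r\<close>.\<close>

lemma bracket_terms_lin:
  "bracket_terms (\<lambda>y. f y *\<^sub>R \<alpha> y + g y *\<^sub>R \<beta> y) Xs r \<psi> =
    f (proj B r) * bracket_terms \<alpha> Xs r \<psi> + g (proj B r) * bracket_terms \<beta> Xs r \<psi>"
  unfolding bracket_terms_def plus_fun_apply scaleR_fun_apply real_scaleR_def
  by (simp only: sum_distrib_left distrib_left sum.distrib mult.left_commute)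

text \<open>One rule for two purposes: constant coefficients give linearity of \<open>d\<close>,
  which \<open>covariant_ext_derivative\<close> does not contain, and \<open>\<beta> = 0\<close>
  gives the commutator with a function.\<close>

lemma d_leibniz:
  assumes \<alpha>: "\<alpha> \<in> sym_forms B p q" and \<beta>: "\<beta> \<in> sym_forms B p q"
    and f: "smooth_fun_on (base B) UNIV f" and g: "smooth_fun_on (base B) UNIV g"
  shows "d (\<lambda>y. f y *\<^sub>R \<alpha> y + g y *\<^sub>R \<beta> y) x = (f x *\<^sub>R d \<alpha> x + g x *\<^sub>R d \<beta> x) +
    (wedge (differential (base B) f x) (\<alpha> x) + wedge (differential (base B) g x) (\<beta> x))"
proof (rule form_eqI)
  note comb = sym_forms_lin_comb[OF \<alpha> \<beta> f g]
  show "d (\<lambda>y. f y *\<^sub>R \<alpha> y + g y *\<^sub>R \<beta> y) x \<in> alt_forms (Suc p) (tspace (base B) x) (sym_pow q (ad_fibre B x))"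
    by (intro sym_forms_alt d_sym_forms comb)
  note add = subspace_add[OF subspace_alt_forms[OF subspace_sym_pow]]
  show "(f x *\<^sub>R d \<alpha> x + g x *\<^sub>R d \<beta> x) +
    (wedge (differential (base B) f x) (\<alpha> x) + wedge (differential (base B) g x) (\<beta> x))
    \<in> alt_forms (Suc p) (tspace (base B) x) (sym_pow q (ad_fibre B x))"
    by (intro add[OF alt_forms_lin_comb add] wedge_alt_forms M.subspace_tspace subspace_sym_pow
        M.differential_dual f g sym_forms_alt d_sym_forms \<alpha> \<beta>)
  fix U Xs r \<psi>
  assume U: "open U" and Xs: "length Xs = Suc p" "\<forall>X\<in>set Xs. vfield_on (base B) U X"
    and x: "x \<in> U" and r: "proj B r = x" and \<psi>: "\<psi> \<in> dual (liealg B)"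
  have rU: "proj B r \<in> U" using x r by simp
  show "d (\<lambda>y. f y *\<^sub>R \<alpha> y + g y *\<^sub>R \<beta> y) x (map (\<lambda>X. X x) Xs) (coad_class B r \<psi>) =
    ((f x *\<^sub>R d \<alpha> x + g x *\<^sub>R d \<beta> x) +
    (wedge (differential (base B) f x) (\<alpha> x) + wedge (differential (base B) g x) (\<beta> x)))
    (map (\<lambda>X. X x) Xs) (coad_class B r \<psi>)"
    using d_eval[OF comb U Xs rU \<psi>] d_eval[OF \<alpha> U Xs rU \<psi>] d_eval[OF \<beta> U Xs rU \<psi>]
      cov_terms_leibniz[OF \<alpha> \<beta> f g U rU Xs \<psi>] bracket_terms_lin[of f \<alpha> g \<beta> Xs r \<psi>]
    unfolding r by (simp add: distrib_left)
qed

lemma differential_const: "differential (base B) (\<lambda>x. a) x = (\<lambda>v. 0)"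
  by (simp add: differential_def M.dirder_const fun_eq_iff)

lemma d_lin:
  assumes "\<alpha> \<in> sym_forms B p q" "\<beta> \<in> sym_forms B p q"
  shows "d (\<lambda>y. a *\<^sub>R \<alpha> y + b *\<^sub>R \<beta> y) x = a *\<^sub>R d \<alpha> x + b *\<^sub>R d \<beta> x"
  using d_leibniz[OF assms M.smooth_fun_on_const M.smooth_fun_on_const]
  by (simp add: differential_const wedge_zero_left)

lemma d_zero: "d (\<lambda>y. 0) x = 0"
  using d_lin[OF sym_forms_zero sym_forms_zero, of 0 0] by simp

lemma d_scaleR:
  assumes "\<alpha> \<in> sym_forms B p q" "smooth_fun_on (base B) UNIV f"
  shows "d (\<lambda>y. f y *\<^sub>R \<alpha> y) x = f x *\<^sub>R d \<alpha> x + wedge (differential (base B) f x) (\<alpha> x)"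
  using d_leibniz[OF assms(1) sym_forms_zero assms(2) M.smooth_fun_on_const, of 0]
  by (simp add: differential_const wedge_zero_left)

text \<open>\<open>on_forms\<close> applies \<delta> also to the default value 0 that a form takes
  outside its domain; this keeps that value 0.\<close>

lemma delta_zero: "\<delta> x 0 = 0"
proof -
  have "lin_on (sym_pow q (ad_fibre B x)) (\<delta> x)" for q
    using delta by (simp add: zero_order_raising_def)
  then show ?thesis using lin_on_apply_zero[OF _ subspace_sym_pow] by blast
qed

lemma on_forms_zero: "on_forms \<delta> (\<lambda>y. 0) = (\<lambda>y. 0)"
  by (simp add: on_forms_def delta_zero fun_eq_iff)

lemma on_forms_sym_forms: "\<alpha> \<in> sym_forms B p q \<Longrightarrow> on_forms \<delta> \<alpha> \<in> sym_forms B p (Suc q)"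
  using delta unfolding zero_order_raising_def by blast

text \<open>The coefficients \<open>f\<close> and \<open>g\<close> are arbitrary functions: \<delta>
  acts point by point, which is what makes it an operator of order zero.\<close>

lemma on_forms_lin:
  assumes "\<alpha> \<in> sym_forms B p q" "\<beta> \<in> sym_forms B p q"
  shows "on_forms \<delta> (\<lambda>y. f y *\<^sub>R \<alpha> y + g y *\<^sub>R \<beta> y) x = f x *\<^sub>R on_forms \<delta> \<alpha> x + g x *\<^sub>R on_forms \<delta> \<beta> x"
proof
  note alt = sym_forms_alt[OF assms(1), of x] sym_forms_alt[OF assms(2), of x]
  have lin: "lin_on (sym_pow q (ad_fibre B x)) (\<delta> x)"
    using delta by (simp add: zero_order_raising_def)
  show "on_forms \<delta> (\<lambda>y. f y *\<^sub>R \<alpha> y + g y *\<^sub>R \<beta> y) x vs =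
      (f x *\<^sub>R on_forms \<delta> \<alpha> x + g x *\<^sub>R on_forms \<delta> \<beta> x) vs" for vs
  proof (cases "length vs = p \<and> set vs \<subseteq> tspace (base B) x")
    case True
    then show ?thesis
      using lin alt_forms_mem[OF alt(1)] alt_forms_mem[OF alt(2)] unfolding lin_on_def
      by (simp add: on_forms_def)
  next
    case False
    then show ?thesis
      using alt_forms_outside[OF alt(1)] alt_forms_outside[OF alt(2)] by (simp add: on_forms_def delta_zero)
  qed
qed

text \<open>Above degree \<open>N\<close> the component is 0 and lies in
  \<open>sym_forms B p q\<close> for every \<open>q\<close>, so \<open>q\<close> is tied to
  \<open>N - p\<close> only where this difference is not truncated.\<close>

lemma S_section_component:
  assumes "s \<in> S_sections B N" "p \<le> N \<longrightarrow> q = N - p"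
  shows "(\<lambda>x. s x p) \<in> sym_forms B p q"
proof (cases "p \<le> N")
  case False
  then have "(\<lambda>x. s x p) = (\<lambda>x. 0)" using assms(1) by (auto simp: S_sections_def S_fibre_def)
  then show ?thesis using sym_forms_zero by simp
qed (use assms in \<open>auto simp: S_sections_def\<close>)

lemma S_section_above: "s \<in> S_sections B N \<Longrightarrow> N < p \<Longrightarrow> (\<lambda>x. s x p) = (\<lambda>x. 0)"
  by (auto simp: S_sections_def S_fibre_def)

lemma S_sectionsI:
  assumes "\<And>p. p \<le> N \<Longrightarrow> (\<lambda>x. s x p) \<in> sym_forms B p (N - p)" "\<And>p x. N < p \<Longrightarrow> s x p = 0"
  shows "s \<in> S_sections B N"
  using assms sym_forms_alt[OF assms(1)] unfolding S_sections_def S_fibre_def by simp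

section \<open>The operator of the total complex and its symbol\<close>

abbreviation "D \<equiv> D_op d \<delta> t"

lemma D_sections:
  assumes s: "s \<in> S_sections B N"
  shows "D s \<in> S_sections B (Suc N)"
proof (rule S_sectionsI)
  fix p assume p: "p \<le> Suc N"
  have 1: "(\<lambda>x. if p = 0 then 0 else d (\<lambda>y. s y (p - 1)) x) \<in> sym_forms B p (Suc N - p)"
  proof (cases p)
    case (Suc p')
    then show ?thesis using d_sym_forms[OF S_section_component[OF s, of p' "N - p'"]] by simp
  qed (simp add: sym_forms_zero)
  have 2: "on_forms \<delta> (\<lambda>y. s y p) \<in> sym_forms B p (Suc N - p)"
  proof (cases "p \<le> N")
    case True
    then show ?thesis
      using on_forms_sym_forms[OF S_section_component[OF s, of p "N - p"]] by (simp add: Suc_diff_le)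
  next
    \<comment> \<open>Here \<open>p = Suc N\<close>, one above the top form degree of
      \<open>s\<close>, and only \<open>d\<close> contributes.\<close>
    case False
    then show ?thesis using S_section_above[OF s, of p] by (simp add: on_forms_zero sym_forms_zero)
  qed
  show "(\<lambda>x. D s x p) \<in> sym_forms B p (Suc N - p)"
    using sym_forms_lin_comb[OF 1 2 M.smooth_fun_on_const[of UNIV 1] M.smooth_fun_on_const[of UNIV "(-1) ^ p * t"]]
    by (simp add: D_op_def)
next
  fix p x assume "Suc N < p"
  then show "D s x p = 0"
    using S_section_above[OF s, of p] S_section_above[OF s, of "p - 1"]
    by (simp add: D_op_def on_forms_zero d_zero)
qed

lemma D_lin: "lin_on (S_sections B N) D"
  unfolding lin_on_def
proof (intro ballI allI)
  fix s s' a b assume s: "s \<in> S_sections B N" "s' \<in> S_sections B N"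
  show "D (a *\<^sub>R s + b *\<^sub>R s') = a *\<^sub>R D s + b *\<^sub>R D s'"
  proof (intro ext)
    fix x p
    have "d (\<lambda>y. a *\<^sub>R s y (p - 1) + b *\<^sub>R s' y (p - 1)) x =
        a *\<^sub>R d (\<lambda>y. s y (p - 1)) x + b *\<^sub>R d (\<lambda>y. s' y (p - 1)) x"
      using S_section_component[OF s(1)] S_section_component[OF s(2)] by (intro d_lin) blast+
    moreover have "on_forms \<delta> (\<lambda>y. a *\<^sub>R s y p + b *\<^sub>R s' y p) x =
        a *\<^sub>R on_forms \<delta> (\<lambda>y. s y p) x + b *\<^sub>R on_forms \<delta> (\<lambda>y. s' y p) x"
      using S_section_component[OF s(1)] S_section_component[OF s(2)] by (intro on_forms_lin) blast+
    ultimately have "D (a *\<^sub>R s + b *\<^sub>R s') x p = (a *\<^sub>R D s + b *\<^sub>R D s') x p"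
      by (simp add: D_op_def scaleR_right_distrib mult.commute)
    then show "D (a *\<^sub>R s + b *\<^sub>R s') x p vs \<phi> = (a *\<^sub>R D s + b *\<^sub>R D s') x p vs \<phi>" for vs \<phi>
      by metis
  qed
qed

text \<open>Indexed by the form degree of the target: component \<open>p\<close> reads component
  \<open>p - 1\<close> of the source, and component 0 receives nothing.\<close>

definition symbol :: "(('m, 'e) tvec \<Rightarrow> real) \<Rightarrow> (nat \<Rightarrow> ('m, 'e, 'g, 'k, 'p) form) \<Rightarrow>
    nat \<Rightarrow> ('m, 'e, 'g, 'k, 'p) form" where
  "symbol \<xi> u = (\<lambda>p. if p = 0 then 0 else wedge \<xi> (u (p - 1)))"

lemma D_leibniz:
  assumes s: "s \<in> S_sections B N" and f: "smooth_fun_on (base B) UNIV f"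
  shows "D (\<lambda>y. f y *\<^sub>R s y) x - f x *\<^sub>R D s x = symbol (differential (base B) f x) (s x)"
proof
  fix p
  \<comment> \<open>For \<open>p = 0\<close> truncated subtraction makes this a claim about
    component 0, which is harmless because \<open>D_op\<close> and \<open>symbol\<close> both drop
    the term there.\<close>
  have "d (\<lambda>y. f y *\<^sub>R s y (p - 1)) x =
      f x *\<^sub>R d (\<lambda>y. s y (p - 1)) x + wedge (differential (base B) f x) (s x (p - 1))"
    using d_scaleR[OF S_section_component[OF s] f] by blast
  moreover have "on_forms \<delta> (\<lambda>y. f y *\<^sub>R s y p) x = f x *\<^sub>R on_forms \<delta> (\<lambda>y. s y p) x"
    using on_forms_lin[OF S_section_component[OF s, of p "N - p"] sym_forms_zero, of f "\<lambda>y. 0" x] by simp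
  ultimately show "(D (\<lambda>y. f y *\<^sub>R s y) x - f x *\<^sub>R D s x) p = symbol (differential (base B) f x) (s x) p"
    by (simp add: D_op_def symbol_def scaleR_right_distrib mult.commute)
qed

lemma symbol_fibre:
  assumes "\<xi> \<in> dual (tspace (base B) x)" "u \<in> S_fibre B N x"
  shows "symbol \<xi> u \<in> S_fibre B (Suc N) x"
proof -
  have "symbol \<xi> u p \<in> alt_forms p (tspace (base B) x) (sym_pow (Suc N - p) (ad_fibre B x))"
    if "p \<le> Suc N" for p
  proof (cases p)
    case 0
    then show ?thesis
      using subspace_0[OF subspace_alt_forms[OF subspace_sym_pow]] by (simp add: symbol_def)
  next
    case (Suc p')
    then have "u p' \<in> alt_forms p' (tspace (base B) x) (sym_pow (N - p') (ad_fibre B x))"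
      using assms(2) that by (simp add: S_fibre_def)
    then show ?thesis
      using wedge_alt_forms[OF M.subspace_tspace subspace_sym_pow assms(1)] Suc by (simp add: symbol_def)
  qed
  moreover have "symbol \<xi> u p = 0" if "Suc N < p" for p
    using assms(2) that by (simp add: S_fibre_def symbol_def wedge_zero)
  ultimately show ?thesis by (simp add: S_fibre_def)
qed

lemma principal_symbol_D:
  "has_principal_symbol (base B) (S_fibre B N) (S_fibre B (Suc N)) (S_sections B N) (S_sections B (Suc N))
    D (\<lambda>x. symbol)"
  unfolding has_principal_symbol_def
proof (intro conjI allI ballI impI image_subsetI D_lin)
  show "D s \<in> S_sections B (Suc N)" if "s \<in> S_sections B N" for s using D_sections that .
  show "symbol \<xi> u \<in> S_fibre B (Suc N) x" if "\<xi> \<in> dual (tspace (base B) x)" "u \<in> S_fibre B N x" for x \<xi> u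
    using symbol_fibre that .
  show "lin_on (S_fibre B N x) (symbol \<xi>)" for x \<xi>
    unfolding lin_on_def
  \<comment> \<open>Extensionality is used in the form degree only; the components are themselves
    functions.\<close>
  proof (intro ballI allI ext[where 'a = nat])
    fix u v a b p
    have "lin_on UNIV (wedge \<xi> :: ('m, 'e, 'g, 'k, 'p) form \<Rightarrow> _)" by (rule lin_on_wedge)
    then show "symbol \<xi> (a *\<^sub>R u + b *\<^sub>R v) p = (a *\<^sub>R symbol \<xi> u + b *\<^sub>R symbol \<xi> v) p"
      by (simp add: symbol_def lin_on_def)
  qed
  show "lin_on (dual (tspace (base B) x)) (\<lambda>\<xi>. symbol \<xi> u)" for x u
    unfolding lin_on_def
  proof (intro ballI allI ext[where 'a = nat])
    fix \<xi> \<eta> a b p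
    show "symbol (a *\<^sub>R \<xi> + b *\<^sub>R \<eta>) u p = (a *\<^sub>R symbol \<xi> u + b *\<^sub>R symbol \<eta> u) p"
      by (simp add: symbol_def wedge_lin_left)
  qed
  show "D (\<lambda>y. f y *\<^sub>R s y) x - f x *\<^sub>R D s x = symbol (differential (base B) f x) (s x)"
    if "smooth_fun_on (base B) UNIV f \<and> s \<in> S_sections B N" for f s x
    using D_leibniz that by blast
qed

text \<open>Component \<open>p + 1\<close> at level \<open>N\<close> and component \<open>p\<close>
  at level \<open>N - 1\<close> have the same symmetric degree, so \<open>wedge_kernel\<close>
  applies to each component separately and a preimage is assembled from componentwise
  choices.\<close>

lemma symbol_kernel:
  assumes \<xi>: "\<xi> \<in> dual (tspace (base B) x)" "\<xi> \<noteq> 0"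
  shows "{u \<in> S_fibre B N x. symbol \<xi> u = 0} = (if N = 0 then {0} else symbol \<xi> ` S_fibre B (N - 1) x)"
proof -
  note kernel = wedge_kernel[OF M.subspace_tspace subspace_sym_pow \<xi>]
  have zero: "u p = 0" if "u \<in> S_fibre B N x" "N < p" for u p using that by (simp add: S_fibre_def)
  have form: "u p \<in> {\<alpha> \<in> alt_forms p (tspace (base B) x) (sym_pow (N - p) (ad_fibre B x)). wedge \<xi> \<alpha> = 0}"
    if "u \<in> S_fibre B N x" "symbol \<xi> u = 0" "p \<le> N" for u p
  proof -
    have "wedge \<xi> (u p) = symbol \<xi> u (Suc p)" by (simp add: symbol_def)
    then have "wedge \<xi> (u p) = 0" using that(2) by simp
    then show ?thesis using that(1,3) by (simp add: S_fibre_def)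
  qed
  have u0: "u 0 = 0" if "u \<in> S_fibre B N x" "symbol \<xi> u = 0" for u
    using form[OF that, of 0] unfolding kernel by simp
  have "symbol \<xi> (symbol \<xi> w) = 0" for w
    by (auto simp: symbol_def fun_eq_iff wedge_wedge wedge_zero[unfolded fun_eq_iff])
  moreover have "0 \<in> S_fibre B 0 x" "symbol \<xi> 0 = 0"
    using subspace_0[OF subspace_alt_forms[OF subspace_sym_pow]]
    by (auto simp: S_fibre_def symbol_def fun_eq_iff wedge_zero[unfolded fun_eq_iff])
  moreover have "u \<in> symbol \<xi> ` S_fibre B N' x"
    if N: "N = Suc N'" and u: "u \<in> S_fibre B N x" "symbol \<xi> u = 0" for u N'
  proof -
    have "\<exists>\<beta>. \<beta> \<in> alt_forms p (tspace (base B) x) (sym_pow (N' - p) (ad_fibre B x)) \<and> u (Suc p) = wedge \<xi> \<beta>"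
      if "p \<le> N'" for p
      using form[OF u, of "Suc p"] that unfolding kernel N by auto
    then obtain w where w: "\<And>p. p \<le> N' \<Longrightarrow>
        w p \<in> alt_forms p (tspace (base B) x) (sym_pow (N' - p) (ad_fibre B x)) \<and> u (Suc p) = wedge \<xi> (w p)"
      by metis
    \<comment> \<open>Above \<open>N'\<close> the choice \<open>w\<close> is unconstrained and has
      to be reset to 0 to lie in the fibre.\<close>
    define w' where "w' p = (if p \<le> N' then w p else 0)" for p
    have "w' \<in> S_fibre B N' x" using w by (simp add: S_fibre_def w'_def)
    moreover have "u p = symbol \<xi> w' p" for p
    proof (cases p)
      case 0
      then show ?thesis using u0[OF u] by (simp add: symbol_def)
    next
      case (Suc p')
      then show ?thesis using w[of p'] zero[OF u(1), of p] N by (auto simp: symbol_def w'_def wedge_zero)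
    qed
    ultimately show ?thesis by blast
  qed
  moreover have "u = 0" if "N = 0" "u \<in> S_fibre B N x" "symbol \<xi> u = 0" for u
  proof
    show "u p = 0 p" for p using u0[OF that(2,3)] zero[OF that(2), of p] that(1) by (cases p) auto
  qed
  ultimately show ?thesis
    using symbol_fibre[OF \<xi>(1), of _ "N - 1"] by (cases N) auto
qed

lemma exact_symbols_D: "exact_symbols (base B) (S_fibre B) (S_sections B) (\<lambda>N. D)"
  unfolding exact_symbols_def
  using principal_symbol_D symbol_kernel by (intro exI[of _ "\<lambda>N x. symbol"]) blast

text \<open>In form degree \<open>p\<close> the square consists of \<open>d\<close> squared,
  \<delta> squared and two cross terms. Since \<open>d\<close> and \<delta> commute, both cross
  terms are multiples of \<open>on_forms \<delta> (d (c (p - 1)))\<close>, with signs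
  \<open>(-1) ^ (p - 1)\<close> and \<open>(-1) ^ p\<close>: the sign in \<open>D_op\<close> is
  there to make them cancel.\<close>

lemma D_square:
  assumes delta_square: "\<And>x q F. F \<in> sym_pow q (ad_fibre B x) \<Longrightarrow> \<delta> x (\<delta> x F) = 0"
    and d_delta: "\<And>p q \<alpha>. \<alpha> \<in> sym_forms B p q \<Longrightarrow> d (on_forms \<delta> \<alpha>) = on_forms \<delta> (d \<alpha>)"
    and flat: "\<And>p q \<alpha>. \<alpha> \<in> sym_forms B p q \<Longrightarrow> d (d \<alpha>) = 0"
    and s: "s \<in> S_sections B N"
  shows "D (D s) = 0"
proof -
  define c where "c p y = s y p" for p y
  have c: "c p \<in> sym_forms B p (N - p)" for p
    using S_section_component[OF s, of p "N - p"] by (simp add: c_def[abs_def])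
  have c0: "c p = (\<lambda>y. 0)" if "N < p" for p
    using S_section_above[OF s that] by (simp add: c_def[abs_def])
  have \<delta>\<delta>: "on_forms \<delta> (on_forms \<delta> (c p)) x = 0" for p x
  proof
    show "on_forms \<delta> (on_forms \<delta> (c p)) x vs = 0 vs" for vs
      using delta_square[of "c p x vs"] alt_forms_mem[OF sym_forms_alt[OF c[of p], of x], of vs]
        alt_forms_outside[OF sym_forms_alt[OF c[of p], of x], of vs]
      by (cases "length vs = p \<and> set vs \<subseteq> tspace (base B) x") (auto simp: on_forms_def delta_zero)
  qed
  have D0: "D s y 0 = t *\<^sub>R on_forms \<delta> (c 0) y" for y by (simp add: D_op_def c_def[abs_def])
  \<comment> \<open>The factor 1 puts the sum into the shape that \<open>d_lin\<close> and
    \<open>on_forms_lin\<close> expect.\<close>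
  have DS: "D s y (Suc p) = 1 *\<^sub>R d (c p) y + ((-1) ^ Suc p * t) *\<^sub>R on_forms \<delta> (c (Suc p)) y" for y p
    by (simp add: D_op_def c_def[abs_def])
  \<comment> \<open>This is the bidegree of \<open>d (c p)\<close>, so the two summands of
    \<open>DS\<close> can be combined. Beyond \<open>N\<close>, where truncated subtraction spoils
    the count, the component is 0.\<close>
  have sd: "on_forms \<delta> (c (Suc p)) \<in> sym_forms B (Suc p) (N - p)" for p
  proof (cases "Suc p \<le> N")
    case True
    then show ?thesis using on_forms_sym_forms[OF c[of "Suc p"]] by (simp add: Suc_diff_Suc)
  next
    case False
    then show ?thesis using c0[of "Suc p"] by (simp add: on_forms_zero sym_forms_zero)
  qed
  have dDS: "d (\<lambda>y. D s y (Suc p)) x = ((-1) ^ Suc p * t) *\<^sub>R on_forms \<delta> (d (c (Suc p))) x" for p x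
    unfolding DS using d_lin[OF d_sym_forms[OF c] sd[of p], of 1 "(-1) ^ Suc p * t" x]
      flat[OF c[of p]] d_delta[OF c[of "Suc p"]] by simp
  have dD0: "d (\<lambda>y. D s y 0) x = t *\<^sub>R on_forms \<delta> (d (c 0)) x" for x
    unfolding D0
    using d_lin[OF on_forms_sym_forms[OF c[of 0]] sym_forms_zero, of t 0 x] d_delta[OF c[of 0]] by simp
  have \<delta>DS: "on_forms \<delta> (\<lambda>y. D s y (Suc p)) x = on_forms \<delta> (d (c p)) x" for p x
    unfolding DS using on_forms_lin[OF d_sym_forms[OF c] sd[of p], of "\<lambda>_. 1" "\<lambda>_. (-1) ^ Suc p * t" x] \<delta>\<delta>
    by simp
  have \<delta>D0: "on_forms \<delta> (\<lambda>y. D s y 0) x = 0" for x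
    unfolding D0
    using on_forms_lin[OF on_forms_sym_forms[OF c[of 0]] sym_forms_zero, of "\<lambda>_. t" "\<lambda>_. 0" x] \<delta>\<delta> by simp
  have "D (D s) x p = 0" for x p
  proof (cases p)
    case 0
    then show ?thesis by (simp add: D_op_def[of d \<delta> t "D s"] \<delta>D0)
  next
    case (Suc p')
    have "D (D s) x p = d (\<lambda>y. D s y p') x + ((-1) ^ Suc p' * t) *\<^sub>R on_forms \<delta> (d (c p')) x"
      by (simp add: D_op_def[of d \<delta> t "D s"] Suc \<delta>DS)
    moreover have "d (\<lambda>y. D s y p') x = ((-1) ^ p' * t) *\<^sub>R on_forms \<delta> (d (c p')) x"
      by (cases p') (simp_all only: dD0 dDS power_0 mult_1)
    ultimately show ?thesis by simp
  qed
  then show ?thesis by (simp add: fun_eq_iff)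
qed

text \<open>The coordinates of tangent vectors in one chart around \<open>x\<close> provide the
  linear injection into the model space.\<close>

lemma wedge_exact_on_tspace:
  assumes "\<xi> \<in> dual (tspace (base B) x)" "\<xi> \<noteq> 0"
  shows "exact_seq_upto (dim (UNIV :: 'e set))
    (\<lambda>p. alt_forms p (tspace (base B) x) (sym_alg (ad_fibre B x))) (\<lambda>p. wedge \<xi>)"
proof -
  obtain c where c: "c \<in> base B" "x \<in> fst c" by (rule M.chart_at)
  obtain S :: "'e set" where S: "finite S" "span S = UNIV" by (rule M.finite_dim)
  have "lin_on (tspace (base B) x) (\<lambda>v. v c)" by (simp add: lin_on_def)
  then show ?thesis
    using wedge_exact_seq_upto[OF M.subspace_tspace subspace_sym_alg _ M.tspace_inj[OF c] S assms] by blast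
qed

end

text \<open>Exactness of the symbols concerns the first-order part alone. The square of the operator
  contains \<open>d (d \<alpha>)\<close>, in which the curvature of the connection appears, so the
  property of being a complex is concluded under the vanishing of that term.\<close>

theorem propositionA2:
  fixes B :: "('m::{t2_space, second_countable_topology}, 'e::real_normed_vector,
      'g::{t2_space, second_countable_topology}, 'k::real_normed_vector,
      'p::{t2_space, second_countable_topology}, 'r::real_normed_vector) gauge_bundle"
    and lam :: "'m \<Rightarrow> ('g, 'k, 'p) coad_elt"
    and \<delta> :: "('m \<Rightarrow> ('g, 'k, 'p) coad_elt) \<Rightarrow> 'm \<Rightarrow> ('g, 'k, 'p) sym_elt \<Rightarrow> ('g, 'k, 'p) sym_elt"
    and d :: "('m \<Rightarrow> ('m, 'e, 'g, 'k, 'p) form) \<Rightarrow> 'm \<Rightarrow> ('m, 'e, 'g, 'k, 'p) form"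
    and t :: real
    and n :: nat
  assumes principal: "principal_bundle B"
    and conn: "connection B"
    and M_closed: "compact (UNIV :: 'm set)" "connected (UNIV :: 'm set)"
    and G_compact: "compact (UNIV :: 'g set)" "connected (UNIV :: 'g set)"
    and G_semisimple: "semisimple (grp B) (mul B) (unit B)"
    and lam: "parallel_coad_section B lam"
    and d: "covariant_ext_derivative B d"
    and delta: "zero_order_raising B (\<delta> lam)"
    and delta_square: "\<And>x q F. F \<in> sym_pow q (ad_fibre B x) \<Longrightarrow> \<delta> lam x (\<delta> lam x F) = 0"
    and d_delta: "\<And>p q \<alpha>. \<alpha> \<in> sym_forms B p q \<Longrightarrow>
        d (on_forms (\<delta> lam) \<alpha>) = on_forms (\<delta> lam) (d \<alpha>)"
    and n: "n = dim (UNIV :: 'e set)"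
  shows "(\<forall>x. \<forall>\<xi>\<in>dual (tspace (base B) x). \<xi> \<noteq> 0 \<longrightarrow>
            exact_seq_upto n
              (\<lambda>p. alt_forms p (tspace (base B) x) (sym_alg (ad_fibre B x))) (\<lambda>p. wedge \<xi>))
       \<and> exact_symbols (base B) (S_fibre B) (S_sections B) (\<lambda>N. D_op d (\<delta> lam) t)
       \<and> ((\<forall>p q. \<forall>\<alpha>\<in>sym_forms B p q. d (d \<alpha>) = 0) \<longrightarrow>
            elliptic_complex (base B) (S_fibre B) (S_sections B) (\<lambda>N. D_op d (\<delta> lam) t))"
proof -
  interpret gauge_complex B d "\<delta> lam" t
    using principal conn d delta by unfold_locales
  have "elliptic_complex (base B) (S_fibre B) (S_sections B) (\<lambda>N. D_op d (\<delta> lam) t)"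
    if flat: "\<forall>p q. \<forall>\<alpha>\<in>sym_forms B p q. d (d \<alpha>) = 0"
    unfolding elliptic_complex_def
  proof (intro conjI allI ballI exact_symbols_D)
    fix N s assume s: "s \<in> S_sections B N"
    show "D_op d (\<delta> lam) t (D_op d (\<delta> lam) t s) = 0"
    proof (rule D_square[OF _ _ _ s])
      show "\<delta> lam x (\<delta> lam x F) = 0" if "F \<in> sym_pow q (ad_fibre B x)" for x q F
        using delta_square that .
      show "d (on_forms (\<delta> lam) \<alpha>) = on_forms (\<delta> lam) (d \<alpha>)" if "\<alpha> \<in> sym_forms B p q" for p q \<alpha>
        using d_delta that .
      show "d (d \<alpha>) = 0" if "\<alpha> \<in> sym_forms B p q" for p q \<alpha>
        using flat that by blast
    qed
  qed
  then show ?thesis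
    unfolding n using wedge_exact_on_tspace exact_symbols_D by blast
qed

end
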